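(* Let $K$ be a field and let $A$ be a gendo-symmetric finite dimensional $K$-algebra, and consider the bocs $(A,D(A))$ with comultiplication $\mu$ and counit $\epsilon$. 1. The map $\zeta: A\to\operatorname{Hom}_A(D(A),A)$, $\zeta(a)=\epsilon(a(-))$ (that is, $\zeta(a)(x)=\epsilon(ax)$ for $x\in D(A)$), is a ring anti-isomorphism, where $\operatorname{Hom}_A(D(A),A)$ has the ring structure with unit $\epsilon$ and product $f*^{r}g=g\,(f\otimes_A \mathrm{id}_{D(A)})\,\mu$. 2. The ring $\operatorname{Hom}_{A^{e}}(D(A),A)$, with unit $\epsilon$ and product $(f*g)(c)=\sum_{i=1}^n f(c_{1,i})g(c_{2,i})$ for $c\in D(A)$ with $\mu(c)=\sum_{i=1}^n c_{1,i}\otimes c_{2,i}$, is isomorphic to the center $Z(A)$ of $A$.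
   Context: $D=\operatorname{Hom}_K(-,K)$ is the natural duality. $A^{e}=A^{op}\otimes_K A$ is the enveloping algebra, so $\operatorname{Hom}_{A^e}$ denotes $A$-bimodule homomorphisms; $\operatorname{Hom}_A$ denotes homomorphisms of right $A$-modules. In the formula for $*^r$, $A\otimes_A D(A)$ is identified with $D(A)$. Gendo-symmetric: a finite dimensional $K$-algebra $B$ is symmetric if $B\cong D(B)$ as $B$-bimodules. A finite dimensional $K$-algebra $A$ is gendo-symmetric if $A\cong \operatorname{End}_B(M)$ for some finite dimensional symmetric $K$-algebra $B$ and some generator $M\in\operatorname{mod-}B$ (i.e. $B_B$ is a direct summand of a finite direct sum of copies of $M$). For such $A$ there is an idempotent $e$ such that $eA$ is a minimal faithful projective-injective right $A$-module, and $D(A)\cong Ae\otimes_{eAe}eA$ as $A$-bimodules. Bocs: let $W$ be an $A$-bimodule with canonical isomorphisms $c_r: W\to A\otimes_A W$, $c_l: W\to W\otimes_A A$. The pair $(A,W)$ with $A$-bimodule maps $\mu: W\to W\otimes_A W$ and $\epsilon: W\to A$ is a bocs if $(1_W\otimes_A\epsilon)\mu=c_l$, $(\epsilon\otimes_A 1_W)\mu=c_r$ and $(\mu\otimes_A 1_W)\mu=(1_W\otimes_A\mu)\mu$. For any bocs $(A,W)$, the formulas in the claim (with $W$ in place of $D(A)$) define ring structures on $\operatorname{Hom}_A(W,A)$ and $\operatorname{Hom}_{A^e}(W,A)$ with unit $\epsilon$. The bocs structure on $(A,D(A))$ for gendo-symmetric $A$: identify $D(A)$ with $Ae\otimes_{eAe}eA$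 via an $A$-bimodule isomorphism and set $\mu(ae\otimes eb)=(ae\otimes e)\otimes(e\otimes eb)$, $\epsilon(ae\otimes eb)=aeb$ for $a,b\in A$. *)

theory Defs
  imports "HOL-Algebra.Module" "HOL-Algebra.QuotRing" "HOL-Algebra.Free_Abelian_Groups"
begin

section \<open>Algebras, right modules and bimodules\<close>

text \<open>
  As for \<^type>\<open>module\<close>, the fields \<open>mult\<close> and \<open>one\<close> of the records below play no role for modules.
\<close>

record ('s, 'm) rmodule = "'m ring" +
  ract :: "'m \<Rightarrow> 's \<Rightarrow> 'm" (infixl "\<triangleleft>\<index>" 72)

record ('r, 's, 'm) bimodule = "('s, 'm) rmodule" +
  lact :: "'r \<Rightarrow> 'm \<Rightarrow> 'm" (infixr "\<triangleright>\<index>" 73)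

definition finite_dim :: "('k, 'x) ring_scheme \<Rightarrow> ('k, 'v, 'y) module_scheme \<Rightarrow> bool" where
  "finite_dim K V \<longleftrightarrow>
     (\<exists>S. finite S \<and> S \<subseteq> carrier V \<and>
       (\<forall>v\<in>carrier V. \<exists>c\<in>S \<rightarrow> carrier K. v = (\<Oplus>\<^bsub>V\<^esub>s\<in>S. c s \<odot>\<^bsub>V\<^esub> s)))"

text \<open>The locale \<^locale>\<open>algebra\<close> of the library requires commutativity.\<close>

locale fd_algebra = field K + A: ring A + module K A
  for K (structure) and A (structure) +
  assumes smult_mult_left:
      "\<lbrakk>k \<in> carrier K; x \<in> carrier A; y \<in> carrier A\<rbrakk> \<Longrightarrow>
       (k \<odot>\<^bsub>A\<^esub> x) \<otimes>\<^bsub>A\<^esub> y = k \<odot>\<^bsub>A\<^esub> (x \<otimes>\<^bsub>A\<^esub> y)"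
    and smult_mult_right:
      "\<lbrakk>k \<in> carrier K; x \<in> carrier A; y \<in> carrier A\<rbrakk> \<Longrightarrow>
       x \<otimes>\<^bsub>A\<^esub> (k \<odot>\<^bsub>A\<^esub> y) = k \<odot>\<^bsub>A\<^esub> (x \<otimes>\<^bsub>A\<^esub> y)"
    and finite_dimensional: "finite_dim K A"

locale right_module = A: ring A + abelian_group M
  for A (structure) and M (structure) +
  assumes ract_closed:
      "\<lbrakk>m \<in> carrier M; a \<in> carrier A\<rbrakk> \<Longrightarrow> m \<triangleleft>\<^bsub>M\<^esub> a \<in> carrier M"
    and ract_distr_module:
      "\<lbrakk>m \<in> carrier M; m' \<in> carrier M; a \<in> carrier A\<rbrakk> \<Longrightarrow>
       (m \<oplus>\<^bsub>M\<^esub> m') \<triangleleft>\<^bsub>M\<^esub> a = m \<triangleleft>\<^bsub>M\<^esub> a \<oplus>\<^bsub>M\<^esub> m' \<triangleleft>\<^bsub>M\<^esub> a"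
    and ract_distr_ring:
      "\<lbrakk>m \<in> carrier M; a \<in> carrier A; b \<in> carrier A\<rbrakk> \<Longrightarrow>
       m \<triangleleft>\<^bsub>M\<^esub> (a \<oplus>\<^bsub>A\<^esub> b) = m \<triangleleft>\<^bsub>M\<^esub> a \<oplus>\<^bsub>M\<^esub> m \<triangleleft>\<^bsub>M\<^esub> b"
    and ract_mult:
      "\<lbrakk>m \<in> carrier M; a \<in> carrier A; b \<in> carrier A\<rbrakk> \<Longrightarrow>
       m \<triangleleft>\<^bsub>M\<^esub> (a \<otimes>\<^bsub>A\<^esub> b) = (m \<triangleleft>\<^bsub>M\<^esub> a) \<triangleleft>\<^bsub>M\<^esub> b"
    and ract_one: "m \<in> carrier M \<Longrightarrow> m \<triangleleft>\<^bsub>M\<^esub> \<one>\<^bsub>A\<^esub> = m"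

text \<open>
  Bimodules over a \<open>K\<close>-algebra \<open>A\<close>, i.e. modules over the enveloping algebra: the two actions
  of \<open>K\<close> obtained through \<open>A\<close> have to agree.
\<close>

locale bimodule = right_module A M
  for K (structure) and A (structure) and M (structure) +
  assumes lact_closed:
      "\<lbrakk>a \<in> carrier A; m \<in> carrier M\<rbrakk> \<Longrightarrow> a \<triangleright>\<^bsub>M\<^esub> m \<in> carrier M"
    and lact_distr_module:
      "\<lbrakk>a \<in> carrier A; m \<in> carrier M; m' \<in> carrier M\<rbrakk> \<Longrightarrow>
       a \<triangleright>\<^bsub>M\<^esub> (m \<oplus>\<^bsub>M\<^esub> m') = a \<triangleright>\<^bsub>M\<^esub> m \<oplus>\<^bsub>M\<^esub> a \<triangleright>\<^bsub>M\<^esub> m'"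
    and lact_distr_ring:
      "\<lbrakk>a \<in> carrier A; b \<in> carrier A; m \<in> carrier M\<rbrakk> \<Longrightarrow>
       (a \<oplus>\<^bsub>A\<^esub> b) \<triangleright>\<^bsub>M\<^esub> m = a \<triangleright>\<^bsub>M\<^esub> m \<oplus>\<^bsub>M\<^esub> b \<triangleright>\<^bsub>M\<^esub> m"
    and lact_mult:
      "\<lbrakk>a \<in> carrier A; b \<in> carrier A; m \<in> carrier M\<rbrakk> \<Longrightarrow>
       (a \<otimes>\<^bsub>A\<^esub> b) \<triangleright>\<^bsub>M\<^esub> m = a \<triangleright>\<^bsub>M\<^esub> (b \<triangleright>\<^bsub>M\<^esub> m)"
    and lact_one: "m \<in> carrier M \<Longrightarrow> \<one>\<^bsub>A\<^esub> \<triangleright>\<^bsub>M\<^esub> m = m"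
    and lact_ract:
      "\<lbrakk>a \<in> carrier A; m \<in> carrier M; b \<in> carrier A\<rbrakk> \<Longrightarrow>
       (a \<triangleright>\<^bsub>M\<^esub> m) \<triangleleft>\<^bsub>M\<^esub> b = a \<triangleright>\<^bsub>M\<^esub> (m \<triangleleft>\<^bsub>M\<^esub> b)"
    and K_central:
      "\<lbrakk>k \<in> carrier K; m \<in> carrier M\<rbrakk> \<Longrightarrow>
       (k \<odot>\<^bsub>A\<^esub> \<one>\<^bsub>A\<^esub>) \<triangleright>\<^bsub>M\<^esub> m = m \<triangleleft>\<^bsub>M\<^esub> (k \<odot>\<^bsub>A\<^esub> \<one>\<^bsub>A\<^esub>)"

text \<open>The \<open>K\<close>-vector space underlying a right module over a \<open>K\<close>-algebra.\<close>

definition underlying_space ::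
    "('k, 'a, 'x) module_scheme \<Rightarrow> ('a, 'm, 'y) rmodule_scheme \<Rightarrow> ('k, 'm) module" where
  "underlying_space A M =
     \<lparr>carrier = carrier M, monoid.mult = undefined, one = undefined,
      ring.zero = \<zero>\<^bsub>M\<^esub>, add = add M, smult = (\<lambda>k m. m \<triangleleft>\<^bsub>M\<^esub> (k \<odot>\<^bsub>A\<^esub> \<one>\<^bsub>A\<^esub>))\<rparr>"

definition fd_right_module ::
    "('k, 'x) ring_scheme \<Rightarrow> ('k, 'a, 'y) module_scheme \<Rightarrow> ('a, 'm, 'z) rmodule_scheme \<Rightarrow> bool" where
  "fd_right_module K A M \<longleftrightarrow> right_module A M \<and> finite_dim K (underlying_space A M)"

text \<open>
  A subset \<open>S\<close> of \<open>A\<close> with actions given by multiplication: for \<open>S = A\<close> this is the regular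
  bimodule, for \<open>S = Ae\<close> and \<open>S = eA\<close> the left and right modules generated by \<open>e\<close>.
\<close>

definition mult_bimodule :: "('k, 'a, 'x) module_scheme \<Rightarrow> 'a set \<Rightarrow> ('a, 'a, 'a) bimodule" where
  "mult_bimodule A S =
     \<lparr>carrier = S, monoid.mult = undefined, one = undefined, ring.zero = \<zero>\<^bsub>A\<^esub>, add = add A,
      ract = monoid.mult A, lact = monoid.mult A\<rparr>"

abbreviation regular_bimodule :: "('k, 'a, 'x) module_scheme \<Rightarrow> ('a, 'a, 'a) bimodule" where
  "regular_bimodule A \<equiv> mult_bimodule A (carrier A)"

definition left_part :: "('k, 'a, 'x) module_scheme \<Rightarrow> 'a \<Rightarrow> ('a, 'a, 'a) bimodule" where
  "left_part A e = mult_bimodule A ((\<lambda>a. a \<otimes>\<^bsub>A\<^esub> e) ` carrier A)"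

definition right_part :: "('k, 'a, 'x) module_scheme \<Rightarrow> 'a \<Rightarrow> ('a, 'a, 'a) bimodule" where
  "right_part A e = mult_bimodule A ((\<lambda>a. e \<otimes>\<^bsub>A\<^esub> a) ` carrier A)"

definition corner :: "('k, 'a, 'x) module_scheme \<Rightarrow> 'a \<Rightarrow> ('k, 'a, 'x) module_scheme" where
  "corner A e = A\<lparr>carrier := (\<lambda>a. e \<otimes>\<^bsub>A\<^esub> a \<otimes>\<^bsub>A\<^esub> e) ` carrier A, one := e\<rparr>"

definition ring_center :: "('a, 'x) ring_scheme \<Rightarrow> ('a, 'x) ring_scheme" where
  "ring_center A = A\<lparr>carrier := {z \<in> carrier A. \<forall>a\<in>carrier A. z \<otimes>\<^bsub>A\<^esub> a = a \<otimes>\<^bsub>A\<^esub> z}\<rparr>"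

definition opposite_ring :: "('a, 'x) ring_scheme \<Rightarrow> ('a, 'x) ring_scheme" where
  "opposite_ring A = A\<lparr>monoid.mult := (\<lambda>x y. y \<otimes>\<^bsub>A\<^esub> x)\<rparr>"

definition ring_anti_iso :: "('a, 'x) ring_scheme \<Rightarrow> ('b, 'y) ring_scheme \<Rightarrow> ('a \<Rightarrow> 'b) set" where
  "ring_anti_iso R S = ring_iso (opposite_ring R) S"


section \<open>Homomorphisms\<close>

text \<open>Homomorphisms are extensional functions, so that they form honest Hom sets.\<close>

definition rmod_hom ::
    "('s, 'x) ring_scheme \<Rightarrow> ('s, 'm, 'y) rmodule_scheme \<Rightarrow> ('s, 'n, 'z) rmodule_scheme
     \<Rightarrow> ('m \<Rightarrow> 'n) set" where
  "rmod_hom S M N =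
     {f \<in> carrier M \<rightarrow>\<^sub>E carrier N.
        (\<forall>x\<in>carrier M. \<forall>y\<in>carrier M. f (x \<oplus>\<^bsub>M\<^esub> y) = f x \<oplus>\<^bsub>N\<^esub> f y) \<and>
        (\<forall>x\<in>carrier M. \<forall>s\<in>carrier S. f (x \<triangleleft>\<^bsub>M\<^esub> s) = f x \<triangleleft>\<^bsub>N\<^esub> s)}"

definition rmod_iso ::
    "('s, 'x) ring_scheme \<Rightarrow> ('s, 'm, 'y) rmodule_scheme \<Rightarrow> ('s, 'n, 'z) rmodule_scheme
     \<Rightarrow> ('m \<Rightarrow> 'n) set" where
  "rmod_iso S M N = {f \<in> rmod_hom S M N. bij_betw f (carrier M) (carrier N)}"

definition bimod_hom ::
    "('a, 'x) ring_scheme \<Rightarrow> ('a, 'a, 'm, 'y) bimodule_scheme \<Rightarrow> ('a, 'a, 'n, 'z) bimodule_scheme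
     \<Rightarrow> ('m \<Rightarrow> 'n) set" where
  "bimod_hom A M N =
     {f \<in> rmod_hom A M N. \<forall>a\<in>carrier A. \<forall>x\<in>carrier M. f (a \<triangleright>\<^bsub>M\<^esub> x) = a \<triangleright>\<^bsub>N\<^esub> f x}"

definition bimod_iso ::
    "('a, 'x) ring_scheme \<Rightarrow> ('a, 'a, 'm, 'y) bimodule_scheme \<Rightarrow> ('a, 'a, 'n, 'z) bimodule_scheme
     \<Rightarrow> ('m \<Rightarrow> 'n) set" where
  "bimod_iso A M N = {f \<in> bimod_hom A M N. bij_betw f (carrier M) (carrier N)}"

definition algebra_iso ::
    "('k, 'x) ring_scheme \<Rightarrow> ('k, 'a, 'y) module_scheme \<Rightarrow> ('k, 'b, 'z) module_scheme
     \<Rightarrow> ('a \<Rightarrow> 'b) set" where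
  "algebra_iso K A B =
     {f \<in> ring_iso A B. \<forall>k\<in>carrier K. \<forall>x\<in>carrier A. f (k \<odot>\<^bsub>A\<^esub> x) = k \<odot>\<^bsub>B\<^esub> f x}"

definition endo_algebra ::
    "('k, 'b, 'x) module_scheme \<Rightarrow> ('b, 'm, 'y) rmodule_scheme \<Rightarrow> ('k, 'm \<Rightarrow> 'm) module" where
  "endo_algebra B M =
     \<lparr>carrier = rmod_hom B M M,
      monoid.mult = compose (carrier M),
      one = (\<lambda>m\<in>carrier M. m),
      ring.zero = (\<lambda>m\<in>carrier M. \<zero>\<^bsub>M\<^esub>),
      add = (\<lambda>f g. \<lambda>m\<in>carrier M. f m \<oplus>\<^bsub>M\<^esub> g m),
      smult = (\<lambda>k f. \<lambda>m\<in>carrier M. f m \<triangleleft>\<^bsub>M\<^esub> (k \<odot>\<^bsub>B\<^esub> \<one>\<^bsub>B\<^esub>))\<rparr>"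

text \<open>The dual \<open>D(A) = Hom\<^sub>K(A, K)\<close> with \<open>(a f b)(x) = f(b x a)\<close>.\<close>

definition dual_bimodule ::
    "('k, 'x) ring_scheme \<Rightarrow> ('k, 'a, 'y) module_scheme \<Rightarrow> ('a, 'a, 'a \<Rightarrow> 'k) bimodule" where
  "dual_bimodule K A =
     \<lparr>carrier =
        {f \<in> carrier A \<rightarrow>\<^sub>E carrier K.
          (\<forall>x\<in>carrier A. \<forall>y\<in>carrier A. f (x \<oplus>\<^bsub>A\<^esub> y) = f x \<oplus>\<^bsub>K\<^esub> f y) \<and>
          (\<forall>k\<in>carrier K. \<forall>x\<in>carrier A. f (k \<odot>\<^bsub>A\<^esub> x) = k \<otimes>\<^bsub>K\<^esub> f x)},
      monoid.mult = undefined, one = undefined,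
      ring.zero = (\<lambda>x\<in>carrier A. \<zero>\<^bsub>K\<^esub>),
      add = (\<lambda>f g. \<lambda>x\<in>carrier A. f x \<oplus>\<^bsub>K\<^esub> g x),
      ract = (\<lambda>f a. \<lambda>x\<in>carrier A. f (a \<otimes>\<^bsub>A\<^esub> x)),
      lact = (\<lambda>a f. \<lambda>x\<in>carrier A. f (x \<otimes>\<^bsub>A\<^esub> a))\<rparr>"


section \<open>Gendo-symmetric algebras\<close>

definition rsubmodule ::
    "('s, 'x) ring_scheme \<Rightarrow> ('s, 'm, 'y) rmodule_scheme \<Rightarrow> 'm set \<Rightarrow> bool" where
  "rsubmodule S M U \<longleftrightarrow>
     subgroup U (add_monoid M) \<and> (\<forall>u\<in>U. \<forall>s\<in>carrier S. u \<triangleleft>\<^bsub>M\<^esub> s \<in> U)"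

definition direct_summand ::
    "('s, 'x) ring_scheme \<Rightarrow> ('s, 'm, 'y) rmodule_scheme \<Rightarrow> 'm set \<Rightarrow> bool" where
  "direct_summand S M U \<longleftrightarrow>
     rsubmodule S M U \<and>
     (\<exists>V. rsubmodule S M V \<and> U \<inter> V = {\<zero>\<^bsub>M\<^esub>} \<and> U <+>\<^bsub>M\<^esub> V = carrier M)"

definition direct_power :: "('s, 'm, 'y) rmodule_scheme \<Rightarrow> nat \<Rightarrow> ('s, nat \<Rightarrow> 'm) rmodule" where
  "direct_power M n =
     \<lparr>carrier = {..<n} \<rightarrow>\<^sub>E carrier M, monoid.mult = undefined, one = undefined,
      ring.zero = (\<lambda>i\<in>{..<n}. \<zero>\<^bsub>M\<^esub>),
      add = (\<lambda>x y. \<lambda>i\<in>{..<n}. x i \<oplus>\<^bsub>M\<^esub> y i),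
      ract = (\<lambda>x s. \<lambda>i\<in>{..<n}. x i \<triangleleft>\<^bsub>M\<^esub> s)\<rparr>"

definition generator ::
    "('k, 'x) ring_scheme \<Rightarrow> ('k, 'b, 'y) module_scheme \<Rightarrow> ('b, 'm, 'z) rmodule_scheme \<Rightarrow> bool" where
  "generator K B M \<longleftrightarrow>
     fd_right_module K B M \<and>
     (\<exists>n U. direct_summand B (direct_power M n) U \<and>
            rmod_iso B (regular_bimodule B) ((direct_power M n)\<lparr>carrier := U\<rparr>) \<noteq> {})"

definition symmetric_algebra :: "('k, 'x) ring_scheme \<Rightarrow> ('k, 'b, 'y) module_scheme \<Rightarrow> bool" where
  "symmetric_algebra K B \<longleftrightarrow>
     fd_algebra K B \<and> bimod_iso B (regular_bimodule B) (dual_bimodule K B) \<noteq> {}"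

text \<open>
  HOL cannot quantify over the types carrying \<open>B\<close> and \<open>M\<close>, so they are parameters. A theorem
  assuming this property with free type variables covers all \<open>B\<close> and \<open>M\<close>.
\<close>

definition gendo_symmetric ::
    "'b itself \<Rightarrow> 'm itself \<Rightarrow> ('k, 'x) ring_scheme \<Rightarrow> ('k, 'a, 'y) module_scheme \<Rightarrow> bool" where
  "gendo_symmetric _ _ K A \<longleftrightarrow>
     fd_algebra K A \<and>
     (\<exists>(B :: ('k, 'b) module) (M :: ('b, 'm) rmodule).
        symmetric_algebra K B \<and> generator K B M \<and> algebra_iso K A (endo_algebra B M) \<noteq> {})"

text \<open>
  Projectivity and injectivity in the category of finite dimensional right modules. The test
  modules \<open>X\<close>, \<open>Y\<close> live on the type \<open>nat \<Rightarrow> 'k\<close>, which is large enough: it contains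
  a copy of every finite dimensional vector space over \<open>K\<close>, hence (by transport of structure) an
  isomorphic copy of every finite dimensional module.
\<close>

definition projective_module ::
    "('k, 'x) ring_scheme \<Rightarrow> ('k, 'a, 'y) module_scheme \<Rightarrow> ('a, 'm, 'z) rmodule_scheme \<Rightarrow> bool" where
  "projective_module K A P \<longleftrightarrow>
     fd_right_module K A P \<and>
     (\<forall>(X :: ('a, nat \<Rightarrow> 'k) rmodule) (Y :: ('a, nat \<Rightarrow> 'k) rmodule).
        fd_right_module K A X \<longrightarrow> fd_right_module K A Y \<longrightarrow>
        (\<forall>p\<in>rmod_hom A X Y. \<forall>f\<in>rmod_hom A P Y.
           p ` carrier X = carrier Y \<longrightarrow> (\<exists>g\<in>rmod_hom A P X. \<forall>x\<in>carrier P. p (g x) = f x)))"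

definition injective_module ::
    "('k, 'x) ring_scheme \<Rightarrow> ('k, 'a, 'y) module_scheme \<Rightarrow> ('a, 'm, 'z) rmodule_scheme \<Rightarrow> bool" where
  "injective_module K A I \<longleftrightarrow>
     fd_right_module K A I \<and>
     (\<forall>(X :: ('a, nat \<Rightarrow> 'k) rmodule) (Y :: ('a, nat \<Rightarrow> 'k) rmodule).
        fd_right_module K A X \<longrightarrow> fd_right_module K A Y \<longrightarrow>
        (\<forall>i\<in>rmod_hom A X Y. \<forall>f\<in>rmod_hom A X I.
           inj_on i (carrier X) \<longrightarrow> (\<exists>g\<in>rmod_hom A Y I. \<forall>x\<in>carrier X. g (i x) = f x)))"

definition faithful_module ::
    "('a, 'x) ring_scheme \<Rightarrow> ('a, 'm, 'y) rmodule_scheme \<Rightarrow> bool" where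
  "faithful_module A M \<longleftrightarrow>
     (\<forall>a\<in>carrier A. (\<forall>m\<in>carrier M. m \<triangleleft>\<^bsub>M\<^esub> a = \<zero>\<^bsub>M\<^esub>) \<longrightarrow> a = \<zero>\<^bsub>A\<^esub>)"

text \<open>
  Minimality: no proper direct summand is still faithful. (Direct summands of
  projective-injective modules are again projective-injective.)
\<close>

definition minimal_faithful_projective_injective ::
    "('k, 'x) ring_scheme \<Rightarrow> ('k, 'a, 'y) module_scheme \<Rightarrow> ('a, 'm, 'z) rmodule_scheme \<Rightarrow> bool" where
  "minimal_faithful_projective_injective K A M \<longleftrightarrow>
     projective_module K A M \<and> injective_module K A M \<and> faithful_module A M \<and>
     (\<forall>U. direct_summand A M U \<longrightarrow> faithful_module A (M\<lparr>carrier := U\<rparr>) \<longrightarrow> U = carrier M)"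


section \<open>Tensor products\<close>

text \<open>
  \<open>M \<otimes>\<^sub>S N\<close> is the free abelian group on \<open>M \<times> N\<close> modulo the subgroup generated by the relations of
  biadditivity and \<open>S\<close>-balancedness; its elements are cosets of that subgroup.
\<close>

definition tensor_relations ::
    "('s, 'x) ring_scheme \<Rightarrow> ('r, 's, 'm, 'y) bimodule_scheme \<Rightarrow> ('s, 't, 'n, 'z) bimodule_scheme
     \<Rightarrow> (('m \<times> 'n) \<Rightarrow>\<^sub>0 int) set" where
  "tensor_relations S M N =
     {frag_of (m \<oplus>\<^bsub>M\<^esub> m', n) - frag_of (m, n) - frag_of (m', n) | m m' n.
        m \<in> carrier M \<and> m' \<in> carrier M \<and> n \<in> carrier N} \<union>
     {frag_of (m, n \<oplus>\<^bsub>N\<^esub> n') - frag_of (m, n) - frag_of (m, n') | m n n'.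
        m \<in> carrier M \<and> n \<in> carrier N \<and> n' \<in> carrier N} \<union>
     {frag_of (m \<triangleleft>\<^bsub>M\<^esub> s, n) - frag_of (m, s \<triangleright>\<^bsub>N\<^esub> n) | m s n.
        m \<in> carrier M \<and> s \<in> carrier S \<and> n \<in> carrier N}"

definition tensor_kernel ::
    "('s, 'x) ring_scheme \<Rightarrow> ('r, 's, 'm, 'y) bimodule_scheme \<Rightarrow> ('s, 't, 'n, 'z) bimodule_scheme
     \<Rightarrow> (('m \<times> 'n) \<Rightarrow>\<^sub>0 int) set" where
  "tensor_kernel S M N =
     generate (free_Abelian_group (carrier M \<times> carrier N)) (tensor_relations S M N)"

definition tensor_group ::
    "('s, 'x) ring_scheme \<Rightarrow> ('r, 's, 'm, 'y) bimodule_scheme \<Rightarrow> ('s, 't, 'n, 'z) bimodule_scheme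
     \<Rightarrow> (('m \<times> 'n) \<Rightarrow>\<^sub>0 int) set monoid" where
  "tensor_group S M N =
     free_Abelian_group (carrier M \<times> carrier N) Mod tensor_kernel S M N"

definition pure_tensor ::
    "('s, 'x) ring_scheme \<Rightarrow> ('r, 's, 'm, 'y) bimodule_scheme \<Rightarrow> ('s, 't, 'n, 'z) bimodule_scheme
     \<Rightarrow> 'm \<Rightarrow> 'n \<Rightarrow> (('m \<times> 'n) \<Rightarrow>\<^sub>0 int) set" where
  "pure_tensor S M N m n =
     tensor_kernel S M N #>\<^bsub>free_Abelian_group (carrier M \<times> carrier N)\<^esub> frag_of (m, n)"

text \<open>
  The additive map into \<open>P\<close> with \<open>m \<otimes> n \<mapsto> h m n\<close>. The value on a coset \<open>t\<close> is the common
  value of the sums \<open>\<Sum> c\<^sub>i h(m\<^sub>i, n\<^sub>i)\<close> over all representatives \<open>\<Sum> c\<^sub>i (m\<^sub>i, n\<^sub>i)\<close> of \<open>t\<close>. This is well-defined, hence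
  meaningful, only for balanced biadditive \<open>h\<close>, and is used for such \<open>h\<close> only.
\<close>

definition tensor_lift ::
    "('p, 'x) ring_scheme \<Rightarrow> ('m \<Rightarrow> 'n \<Rightarrow> 'p) \<Rightarrow> (('m \<times> 'n) \<Rightarrow>\<^sub>0 int) set \<Rightarrow> 'p" where
  "tensor_lift P h t =
     the_elem ((\<lambda>c. \<Oplus>\<^bsub>P\<^esub>x\<in>Poly_Mapping.keys c.
                      [Poly_Mapping.lookup c x] \<cdot>\<^bsub>P\<^esub> h (fst x) (snd x)) ` t)"

definition tensor ::
    "('s, 'x) ring_scheme \<Rightarrow> ('r, 's, 'm, 'y) bimodule_scheme \<Rightarrow> ('s, 't, 'n, 'z) bimodule_scheme
     \<Rightarrow> ('r, 't, (('m \<times> 'n) \<Rightarrow>\<^sub>0 int) set) bimodule" where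
  "tensor S M N =
     (let T = \<lparr>carrier = carrier (tensor_group S M N),
               monoid.mult = undefined, one = undefined,
               ring.zero = one (tensor_group S M N), add = monoid.mult (tensor_group S M N)\<rparr>
      in ring.extend T
          \<lparr>ract = (\<lambda>t b. tensor_lift T (\<lambda>m n. pure_tensor S M N m (n \<triangleleft>\<^bsub>N\<^esub> b)) t),
           lact = (\<lambda>a t. tensor_lift T (\<lambda>m n. pure_tensor S M N (a \<triangleright>\<^bsub>M\<^esub> m) n) t)\<rparr>)"

text \<open>\<open>f \<otimes> g\<close> on a tensor product, with target \<open>M' \<otimes>\<^sub>S N'\<close>.\<close>

definition tensor_map ::
    "('s, 'x) ring_scheme \<Rightarrow> ('r, 's, 'm2, 'y) bimodule_scheme \<Rightarrow> ('s, 't, 'n2, 'z) bimodule_scheme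
     \<Rightarrow> ('m \<Rightarrow> 'm2) \<Rightarrow> ('n \<Rightarrow> 'n2) \<Rightarrow> (('m \<times> 'n) \<Rightarrow>\<^sub>0 int) set \<Rightarrow> (('m2 \<times> 'n2) \<Rightarrow>\<^sub>0 int) set" where
  "tensor_map S M' N' f g =
     tensor_lift (tensor S M' N') (\<lambda>m n. pure_tensor S M' N' (f m) (g n))"

text \<open>The associativity isomorphism \<open>(W \<otimes> W) \<otimes> W \<cong> W \<otimes> (W \<otimes> W)\<close>, \<open>(x \<otimes> y) \<otimes> z \<mapsto> x \<otimes> (y \<otimes> z)\<close>.\<close>

definition tensor_assoc ::
    "('a, 'x) ring_scheme \<Rightarrow> ('a, 'a, 'w, 'y) bimodule_scheme
     \<Rightarrow> (((('w \<times> 'w) \<Rightarrow>\<^sub>0 int) set \<times> 'w) \<Rightarrow>\<^sub>0 int) set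
     \<Rightarrow> (('w \<times> (('w \<times> 'w) \<Rightarrow>\<^sub>0 int) set) \<Rightarrow>\<^sub>0 int) set" where
  "tensor_assoc A W =
     (let WW = tensor A W W; WWW = tensor A W WW in
      tensor_lift WWW
        (\<lambda>t z. tensor_lift WWW (\<lambda>x y. pure_tensor A W WW x (pure_tensor A W W y z)) t))"


section \<open>Bocses\<close>

definition bocs ::
    "('k, 'x) ring_scheme \<Rightarrow> ('k, 'a) module \<Rightarrow> ('a, 'a, 'w) bimodule
     \<Rightarrow> ('w \<Rightarrow> (('w \<times> 'w) \<Rightarrow>\<^sub>0 int) set) \<Rightarrow> ('w \<Rightarrow> 'a) \<Rightarrow> bool" where
  "bocs K A W \<mu> \<epsilon> \<longleftrightarrow>
     bimodule K A W \<and>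
     \<mu> \<in> bimod_hom A W (tensor A W W) \<and>
     \<epsilon> \<in> bimod_hom A W (regular_bimodule A) \<and>
     (\<forall>w\<in>carrier W. tensor_map A W (regular_bimodule A) (\<lambda>x. x) \<epsilon> (\<mu> w)
                    = pure_tensor A W (regular_bimodule A) w \<one>\<^bsub>A\<^esub>) \<and>
     (\<forall>w\<in>carrier W. tensor_map A (regular_bimodule A) W \<epsilon> (\<lambda>x. x) (\<mu> w)
                    = pure_tensor A (regular_bimodule A) W \<one>\<^bsub>A\<^esub> w) \<and>
     (\<forall>w\<in>carrier W. tensor_assoc A W (tensor_map A (tensor A W W) W \<mu> (\<lambda>x. x) (\<mu> w))
                    = tensor_map A W (tensor A W W) (\<lambda>x. x) \<mu> (\<mu> w))"

text \<open>
  The ring \<open>Hom\<^sub>A(W, A)\<close> of right module homomorphisms with product \<open>g (f \<otimes> id) \<mu>\<close>. The inner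
  \<open>tensor_lift\<close> is the identification \<open>A \<otimes>\<^sub>A W \<cong> W\<close>, \<open>a \<otimes> x \<mapsto> a x\<close>.
\<close>

definition bocs_right_hom_ring ::
    "('k, 'a) module \<Rightarrow> ('a, 'a, 'w) bimodule
     \<Rightarrow> ('w \<Rightarrow> (('w \<times> 'w) \<Rightarrow>\<^sub>0 int) set) \<Rightarrow> ('w \<Rightarrow> 'a) \<Rightarrow> ('w \<Rightarrow> 'a) ring" where
  "bocs_right_hom_ring A W \<mu> \<epsilon> =
     \<lparr>carrier = rmod_hom A W (regular_bimodule A),
      monoid.mult = (\<lambda>f g. \<lambda>x\<in>carrier W.
        g (tensor_lift W (\<lambda>a y. a \<triangleright>\<^bsub>W\<^esub> y)
             (tensor_map A (regular_bimodule A) W f (\<lambda>y. y) (\<mu> x)))),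
      one = \<epsilon>,
      ring.zero = (\<lambda>x\<in>carrier W. \<zero>\<^bsub>A\<^esub>),
      add = (\<lambda>f g. \<lambda>x\<in>carrier W. f x \<oplus>\<^bsub>A\<^esub> g x)\<rparr>"

text \<open>
  The ring of bimodule homomorphisms \<open>W \<rightarrow> A\<close> with product
  \<open>(f * g)(c) = \<Sum> f(c\<^sub>1\<^sub>,\<^sub>i) g(c\<^sub>2\<^sub>,\<^sub>i)\<close> for \<open>\<mu>(c) = \<Sum> c\<^sub>1\<^sub>,\<^sub>i \<otimes> c\<^sub>2\<^sub>,\<^sub>i\<close>.
\<close>

definition bocs_bimod_hom_ring ::
    "('k, 'a) module \<Rightarrow> ('a, 'a, 'w) bimodule
     \<Rightarrow> ('w \<Rightarrow> (('w \<times> 'w) \<Rightarrow>\<^sub>0 int) set) \<Rightarrow> ('w \<Rightarrow> 'a) \<Rightarrow> ('w \<Rightarrow> 'a) ring" where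
  "bocs_bimod_hom_ring A W \<mu> \<epsilon> =
     \<lparr>carrier = bimod_hom A W (regular_bimodule A),
      monoid.mult = (\<lambda>f g. \<lambda>c\<in>carrier W.
        tensor_lift A (\<lambda>x y. f x \<otimes>\<^bsub>A\<^esub> g y) (\<mu> c)),
      one = \<epsilon>,
      ring.zero = (\<lambda>x\<in>carrier W. \<zero>\<^bsub>A\<^esub>),
      add = (\<lambda>f g. \<lambda>x\<in>carrier W. f x \<oplus>\<^bsub>A\<^esub> g x)\<rparr>"

text \<open>
  The bocs structure on \<open>(A, D(A))\<close> determined by an identification \<open>\<phi>\<close> of \<open>Ae \<otimes>\<^bsub>eAe\<^esub> eA\<close> with
  \<open>D(A)\<close>. The equations on pure tensors determine the additive maps \<open>\<mu>\<close> and \<open>\<epsilon>\<close> uniquely.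
\<close>

definition gendo_symmetric_bocs ::
    "('k, 'x) ring_scheme \<Rightarrow> ('k, 'a) module \<Rightarrow> 'a
     \<Rightarrow> ((('a \<times> 'a) \<Rightarrow>\<^sub>0 int) set \<Rightarrow> ('a \<Rightarrow> 'k))
     \<Rightarrow> (('a \<Rightarrow> 'k) \<Rightarrow> ((('a \<Rightarrow> 'k) \<times> ('a \<Rightarrow> 'k)) \<Rightarrow>\<^sub>0 int) set)
     \<Rightarrow> (('a \<Rightarrow> 'k) \<Rightarrow> 'a) \<Rightarrow> bool" where
  "gendo_symmetric_bocs K A e \<phi> \<mu> \<epsilon> \<longleftrightarrow>
     (let DA = dual_bimodule K A;
          pt = pure_tensor (corner A e) (left_part A e) (right_part A e)
      in bocs K A DA \<mu> \<epsilon> \<and>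
         (\<forall>a\<in>carrier A. \<forall>b\<in>carrier A.
            \<mu> (\<phi> (pt (a \<otimes>\<^bsub>A\<^esub> e) (e \<otimes>\<^bsub>A\<^esub> b)))
              = pure_tensor A DA DA (\<phi> (pt (a \<otimes>\<^bsub>A\<^esub> e) e)) (\<phi> (pt e (e \<otimes>\<^bsub>A\<^esub> b)))) \<and>
         (\<forall>a\<in>carrier A. \<forall>b\<in>carrier A.
            \<epsilon> (\<phi> (pt (a \<otimes>\<^bsub>A\<^esub> e) (e \<otimes>\<^bsub>A\<^esub> b))) = a \<otimes>\<^bsub>A\<^esub> e \<otimes>\<^bsub>A\<^esub> b))"

end

theory Submission
  imports Defs
begin

text \<open>
  Let \<open>(A, W)\<close> be a bocs. For a right \<open>A\<close>-linear \<open>f : W \<rightarrow> A\<close> put \<open>G\<^sub>f = (f \<otimes> id) \<mu> : W \<rightarrow> W\<close>,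
  a right \<open>A\<close>-linear map, so that \<open>f *\<^sup>r g = g G\<^sub>f\<close>. The two counit laws give
  \<open>\<epsilon> G\<^sub>f = f\<close> and \<open>G\<^sub>f = a(-)\<close> for \<open>f = \<zeta>(a)\<close>. If every right \<open>A\<close>-endomorphism of \<open>W\<close> is left
  multiplication by a unique element of \<open>A\<close>, then \<open>f \<mapsto> G\<^sub>f\<close> therefore inverts \<open>\<zeta>\<close>, and
  \<open>\<zeta>(a) *\<^sup>r \<zeta>(b) = \<epsilon>(ba(-)) = \<zeta>(ba)\<close>. Moreover \<open>\<zeta>(a)\<close> is left linear iff \<open>a\<close> is central, and
  on bimodule maps both products agree.

  For \<open>W = D(A)\<close> the condition on endomorphisms is duality of finite-dimensional spaces: given an
  endomorphism \<open>G\<close>, the functional \<open>f \<mapsto> G(f)(1)\<close> on \<open>D(A)\<close> is evaluation at some \<open>a\<close>, whence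
  \<open>G(f)(x) = G(f x)(1) = f(x a)\<close>.
\<close>

section \<open>The universal property of the tensor product\<close>

lemma (in comm_group) free_Abelian_group_lift_superset:
  fixes c :: "'c \<Rightarrow>\<^sub>0 int"
  assumes "f \<in> S \<rightarrow> carrier G" and "finite T" and "Poly_Mapping.keys c \<subseteq> T" and "T \<subseteq> S"
  shows "(\<Otimes>x\<in>Poly_Mapping.keys c. f x [^] Poly_Mapping.lookup c x) =
         (\<Otimes>x\<in>T. f x [^] Poly_Mapping.lookup c x)"
proof (rule finprod_mono_neutral_cong_left)
  show "\<And>i. i \<in> T - Poly_Mapping.keys c \<Longrightarrow> f i [^] Poly_Mapping.lookup c i = \<one>"
    by (simp add: in_keys_iff int_pow_0)
  show "(\<lambda>x. f x [^] Poly_Mapping.lookup c x) \<in> T \<rightarrow> carrier G"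
    using assms by (auto intro!: int_pow_closed)
qed (use assms in auto)

text \<open>Cancellation can make the support of \<open>c + d\<close> smaller than the union of the
  two supports. All three products are therefore first extended to the union, where the extra
  exponents are zero, and then multiplied termwise.\<close>

lemma (in comm_group) free_Abelian_group_lift_hom:
  assumes f: "f \<in> S \<rightarrow> carrier G"
  shows "(\<lambda>c. \<Otimes>x\<in>Poly_Mapping.keys c. f x [^] Poly_Mapping.lookup c x)
         \<in> hom (free_Abelian_group S) G" (is "?F \<in> _")
proof (rule homI)
  fix c assume "c \<in> carrier (free_Abelian_group S)"
  with f show "?F c \<in> carrier G"
    by (intro finprod_closed) (auto intro!: int_pow_closed)
next
  fix c d
  assume "c \<in> carrier (free_Abelian_group S)" and "d \<in> carrier (free_Abelian_group S)"
  then have c: "Poly_Mapping.keys c \<subseteq> S" and d: "Poly_Mapping.keys d \<subseteq> S"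
    by auto
  let ?T = "Poly_Mapping.keys c \<union> Poly_Mapping.keys d"
  have T: "finite ?T" "?T \<subseteq> S" using c d by auto
  have "?F (c + d) = (\<Otimes>x\<in>?T. f x [^] Poly_Mapping.lookup (c + d) x)"
    using T by (intro free_Abelian_group_lift_superset[OF f] keys_add) auto
  also have "\<dots> = (\<Otimes>x\<in>?T. f x [^] Poly_Mapping.lookup c x \<otimes> f x [^] Poly_Mapping.lookup d x)"
    using T f
    by (intro finprod_cong) (auto simp: lookup_add simp_implies_def intro!: int_pow_mult int_pow_closed)
  also have "\<dots> = (\<Otimes>x\<in>?T. f x [^] Poly_Mapping.lookup c x) \<otimes>
                   (\<Otimes>x\<in>?T. f x [^] Poly_Mapping.lookup d x)"
    using T f by (intro finprod_multf) (auto intro!: int_pow_closed)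
  also have "\<dots> = ?F c \<otimes> ?F d"
    using T by (simp add: free_Abelian_group_lift_superset[OF f, of ?T])
  finally show "?F (c \<otimes>\<^bsub>free_Abelian_group S\<^esub> d) = ?F c \<otimes> ?F d" by simp
qed

text \<open>Both \<open>tensor_relations\<close> and the induction rule for free abelian groups are
  phrased with subtraction of formal sums rather than with the group operations.\<close>

lemma (in abelian_group) free_Abelian_group_hom_diff:
  assumes "group_hom (free_Abelian_group S) (add_monoid G) k"
    and x: "x \<in> carrier (free_Abelian_group S)" and y: "y \<in> carrier (free_Abelian_group S)"
  shows "k (x - y) = k x \<ominus> k y"
proof -
  interpret k: group_hom "free_Abelian_group S" "add_monoid G" k by fact
  have "k (x \<otimes>\<^bsub>free_Abelian_group S\<^esub> inv\<^bsub>free_Abelian_group S\<^esub> y) = k x \<ominus> k y"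
    unfolding k.hom_mult[OF x k.G.inv_closed[OF y]] k.hom_inv[OF y]
    by (simp add: a_minus_def a_inv_def)
  then show ?thesis using y by simp
qed

section \<open>Balanced maps and the tensor product as a quotient group\<close>

definition balanced ::
    "('s, 'x) ring_scheme \<Rightarrow> ('r, 's, 'm, 'y) bimodule_scheme \<Rightarrow> ('s, 't, 'n, 'z) bimodule_scheme
     \<Rightarrow> ('p, 'w) ring_scheme \<Rightarrow> ('m \<Rightarrow> 'n \<Rightarrow> 'p) \<Rightarrow> bool" where
  "balanced S M N P h \<longleftrightarrow>
     (\<forall>m\<in>carrier M. \<forall>n\<in>carrier N. h m n \<in> carrier P) \<and>
     (\<forall>m\<in>carrier M. \<forall>m'\<in>carrier M. \<forall>n\<in>carrier N. h (m \<oplus>\<^bsub>M\<^esub> m') n = h m n \<oplus>\<^bsub>P\<^esub> h m' n) \<and>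
     (\<forall>m\<in>carrier M. \<forall>n\<in>carrier N. \<forall>n'\<in>carrier N. h m (n \<oplus>\<^bsub>N\<^esub> n') = h m n \<oplus>\<^bsub>P\<^esub> h m n') \<and>
     (\<forall>m\<in>carrier M. \<forall>s\<in>carrier S. \<forall>n\<in>carrier N. h (m \<triangleleft>\<^bsub>M\<^esub> s) n = h m (s \<triangleright>\<^bsub>N\<^esub> n))"

lemma tensor_simps [simp]:
  "carrier (tensor S M N) = carrier (tensor_group S M N)"
  "add (tensor S M N) = monoid.mult (tensor_group S M N)"
  "\<zero>\<^bsub>tensor S M N\<^esub> = \<one>\<^bsub>tensor_group S M N\<^esub>"
  by (simp_all add: tensor_def ring.extend_def Let_def)

text \<open>The actions in \<open>tensor\<close> are lifts into an auxiliary record without actions.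
  A lift sees only the additive structure of its target, so that record may be replaced by
  \<open>tensor S M N\<close> itself.\<close>

lemma tensor_lift_cong:
  assumes "carrier P = carrier Q" and "add P = add Q" and "\<zero>\<^bsub>P\<^esub> = \<zero>\<^bsub>Q\<^esub>"
  shows "tensor_lift P h = tensor_lift Q h"
proof -
  \<comment> \<open>Negative multiples use the additive inverse, which is a description over
    carrier, addition and zero.\<close>
  have inv: "m_inv (add_monoid P) = m_inv (add_monoid Q)"
    using assms by (simp add: fun_eq_iff m_inv_def)
  show ?thesis
    unfolding tensor_lift_def[abs_def] finsum_def finprod_def add_pow_def int_pow_def
      nat_pow_def inv
    unfolding partial_object.simps monoid.simps assms ..
qed

lemma tensor_ract:
  "t \<triangleleft>\<^bsub>tensor S M N\<^esub> b =
   tensor_lift (tensor S M N) (\<lambda>m n. pure_tensor S M N m (n \<triangleleft>\<^bsub>N\<^esub> b)) t"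
proof -
  have "t \<triangleleft>\<^bsub>tensor S M N\<^esub> b =
    tensor_lift \<lparr>carrier = carrier (tensor_group S M N),
               monoid.mult = undefined, one = undefined,
               ring.zero = one (tensor_group S M N), add = monoid.mult (tensor_group S M N)\<rparr>
      (\<lambda>m n. pure_tensor S M N m (n \<triangleleft>\<^bsub>N\<^esub> b)) t"
    by (simp add: tensor_def ring.extend_def Let_def)
  also have "\<dots> = tensor_lift (tensor S M N) (\<lambda>m n. pure_tensor S M N m (n \<triangleleft>\<^bsub>N\<^esub> b)) t"
    by (rule arg_cong[where f = "\<lambda>l. l t"], rule tensor_lift_cong) simp_all
  finally show ?thesis .
qed

text \<open>Besides two abelian groups, only closure of the two actions that meet in the tensor
  product is demanded: it puts the balancing relations into the free group.\<close>

locale tensor_factors = M: abelian_group M + N: abelian_group N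
  for S :: "('s, 'x) ring_scheme" and M :: "('r, 's, 'm, 'y) bimodule_scheme"
    and N :: "('s, 't, 'n, 'z) bimodule_scheme" +
  assumes M_ract_closed: "\<lbrakk>m \<in> carrier M; s \<in> carrier S\<rbrakk> \<Longrightarrow> m \<triangleleft>\<^bsub>M\<^esub> s \<in> carrier M"
    and N_lact_closed: "\<lbrakk>s \<in> carrier S; n \<in> carrier N\<rbrakk> \<Longrightarrow> s \<triangleright>\<^bsub>N\<^esub> n \<in> carrier N"
begin

abbreviation "F \<equiv> free_Abelian_group (carrier M \<times> carrier N)"

sublocale F: comm_group F
  by (rule abelian_free_Abelian_group)

lemma tensor_relations_subset: "tensor_relations S M N \<subseteq> carrier F"
  using M_ract_closed N_lact_closed unfolding tensor_relations_def
  by (auto dest!: subsetD[OF keys_diff] simp: keys_frag_of)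

lemma kernel_normal: "tensor_kernel S M N \<lhd> F"
  unfolding tensor_kernel_def
  by (rule F.normal_iff_subgroup[THEN iffD2, OF F.generate_is_subgroup[OF tensor_relations_subset]])

sublocale kernel: normal "tensor_kernel S M N" F
  by (rule kernel_normal)

abbreviation "proj c \<equiv> tensor_kernel S M N #>\<^bsub>F\<^esub> c"

lemma proj_hom: "proj \<in> hom F (tensor_group S M N)"
  unfolding tensor_group_def by (rule kernel.r_coset_hom_Mod)

lemma tensor_cases:
  assumes "t \<in> carrier (tensor_group S M N)"
  obtains c where "c \<in> carrier F" and "t = proj c"
  using assms unfolding tensor_group_def carrier_FactGroup by blast

lemma tensor_comm_group: "comm_group (tensor_group S M N)"
  unfolding tensor_group_def by (rule F.abelian_FactGroup[OF kernel.subgroup_axioms])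

lemma tensor_abelian_group: "abelian_group (tensor S M N)"
proof -
  interpret T: comm_group "tensor_group S M N" by (rule tensor_comm_group)
  show ?thesis
    by (rule abelian_groupI) (simp_all add: T.m_ac T.l_inv_ex)
qed

lemma proj_eqI:
  assumes "c \<in> carrier F" "d \<in> carrier F" "c - d \<in> tensor_kernel S M N"
  shows "proj c = proj d"
proof -
  have "c \<in> proj d"
    unfolding r_coset_def using assms(3) by (auto intro!: bexI[of _ "c - d"])
  then show ?thesis using F.repr_independence assms(2) kernel.subgroup_axioms by metis
qed

lemma relation_in_kernel: "r \<in> tensor_relations S M N \<Longrightarrow> r \<in> tensor_kernel S M N"
  unfolding tensor_kernel_def by (rule generate.incl)

text \<open>For each law, the difference of the representatives of the two sides is one of the
  generators of the kernel.\<close>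

lemma pure_tensor_balanced: "balanced S M N (tensor S M N) (pure_tensor S M N)"
  unfolding balanced_def
proof (intro conjI ballI)
  fix m n assume mn: "m \<in> carrier M" "n \<in> carrier N"
  show pc: "pure_tensor S M N m n \<in> carrier (tensor S M N)"
    using hom_in_carrier[OF proj_hom, of "frag_of (m, n)"] mn by (simp add: pure_tensor_def)
  { fix m' assume m': "m' \<in> carrier M"
    have "proj (frag_of (m \<oplus>\<^bsub>M\<^esub> m', n)) = proj (frag_of (m, n) + frag_of (m', n))"
    proof (rule proj_eqI)
      have "frag_of (m \<oplus>\<^bsub>M\<^esub> m', n) - frag_of (m, n) - frag_of (m', n) \<in> tensor_relations S M N"
        unfolding tensor_relations_def using mn m' by blast
      then show "frag_of (m \<oplus>\<^bsub>M\<^esub> m', n) - (frag_of (m, n) + frag_of (m', n)) \<in> tensor_kernel S M N"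
        using relation_in_kernel by (simp add: diff_diff_eq)
    qed (use mn m' in \<open>auto dest!: subsetD[OF keys_add]\<close>)
    then show "pure_tensor S M N (m \<oplus>\<^bsub>M\<^esub> m') n =
        pure_tensor S M N m n \<oplus>\<^bsub>tensor S M N\<^esub> pure_tensor S M N m' n"
      using hom_mult[OF proj_hom, of "frag_of (m, n)" "frag_of (m', n)"] mn m'
      by (simp add: pure_tensor_def) }
  { fix n' assume n': "n' \<in> carrier N"
    have "proj (frag_of (m, n \<oplus>\<^bsub>N\<^esub> n')) = proj (frag_of (m, n) + frag_of (m, n'))"
    proof (rule proj_eqI)
      have "frag_of (m, n \<oplus>\<^bsub>N\<^esub> n') - frag_of (m, n) - frag_of (m, n') \<in> tensor_relations S M N"
        unfolding tensor_relations_def using mn n' by blast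
      then show "frag_of (m, n \<oplus>\<^bsub>N\<^esub> n') - (frag_of (m, n) + frag_of (m, n')) \<in> tensor_kernel S M N"
        using relation_in_kernel by (simp add: diff_diff_eq)
    qed (use mn n' in \<open>auto dest!: subsetD[OF keys_add]\<close>)
    then show "pure_tensor S M N m (n \<oplus>\<^bsub>N\<^esub> n') =
        pure_tensor S M N m n \<oplus>\<^bsub>tensor S M N\<^esub> pure_tensor S M N m n'"
      using hom_mult[OF proj_hom, of "frag_of (m, n)" "frag_of (m, n')"] mn n'
      by (simp add: pure_tensor_def) }
next
  fix m s n assume mn: "m \<in> carrier M" "s \<in> carrier S" "n \<in> carrier N"
  have "frag_of (m \<triangleleft>\<^bsub>M\<^esub> s, n) - frag_of (m, s \<triangleright>\<^bsub>N\<^esub> n) \<in> tensor_relations S M N"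
    unfolding tensor_relations_def using mn by blast
  then show "pure_tensor S M N (m \<triangleleft>\<^bsub>M\<^esub> s) n = pure_tensor S M N m (s \<triangleright>\<^bsub>N\<^esub> n)"
    unfolding pure_tensor_def
    by (intro proj_eqI relation_in_kernel) (use mn M_ract_closed N_lact_closed in auto)
qed

text \<open>Uniqueness in the universal property: pulled back along \<open>proj\<close>, both maps
  are homomorphisms on the free group that agree on its basis. Later identities between maps on
  tensor products are reduced to pure tensors this way.\<close>

lemma tensor_hom_eqI:
  assumes P: "abelian_group P"
    and f: "f \<in> hom (tensor_group S M N) (add_monoid P)"
    and g: "g \<in> hom (tensor_group S M N) (add_monoid P)"
    and eq: "\<And>m n. \<lbrakk>m \<in> carrier M; n \<in> carrier N\<rbrakk> \<Longrightarrow>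
                f (pure_tensor S M N m n) = g (pure_tensor S M N m n)"
    and t: "t \<in> carrier (tensor_group S M N)"
  shows "f t = g t"
proof -
  interpret P: abelian_group P by (rule P)
  have hom: "group_hom F (add_monoid P) (k \<circ> proj)"
    if "k \<in> hom (tensor_group S M N) (add_monoid P)" for k
    using hom_compose[OF proj_hom that] P.a_group F.is_group
    by (simp add: group_hom_def group_hom_axioms_def)
  interpret f: group_hom F "add_monoid P" "f \<circ> proj" by (rule hom[OF f])
  interpret g: group_hom F "add_monoid P" "g \<circ> proj" by (rule hom[OF g])
  obtain c where c: "c \<in> carrier F" "t = proj c" using tensor_cases[OF t] .
  have "Poly_Mapping.keys c \<subseteq> carrier M \<times> carrier N" using c by simp
  then have "(f \<circ> proj) c = (g \<circ> proj) c"
  proof (rule free_Abelian_group_induct)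
    show "(f \<circ> proj) 0 = (g \<circ> proj) 0"
      using f.hom_one g.hom_one by simp
  next
    fix x y
    assume "Poly_Mapping.keys x \<subseteq> carrier M \<times> carrier N"
      and "Poly_Mapping.keys y \<subseteq> carrier M \<times> carrier N"
      and "(f \<circ> proj) x = (g \<circ> proj) x" and "(f \<circ> proj) y = (g \<circ> proj) y"
    then show "(f \<circ> proj) (x - y) = (g \<circ> proj) (x - y)"
      using P.free_Abelian_group_hom_diff[OF hom[OF f], of x y]
        P.free_Abelian_group_hom_diff[OF hom[OF g], of x y] by simp
  next
    fix a assume "a \<in> carrier M \<times> carrier N"
    then show "(f \<circ> proj) (frag_of a) = (g \<circ> proj) (frag_of a)"
      using eq[of "fst a" "snd a"] by (auto simp: pure_tensor_def)
  qed
  then show ?thesis using c by simp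
qed

section \<open>Existence of the lift of a balanced map\<close>

context
  fixes P :: "('p, 'w) ring_scheme" and h :: "'m \<Rightarrow> 'n \<Rightarrow> 'p"
  assumes P: "abelian_group P" and h: "balanced S M N P h"
begin

interpretation P: abelian_group P by (rule P)

text \<open>The value that \<open>tensor_lift P h\<close> computes from a single representative,
  before passing to cosets.\<close>

private definition "free_lift c =
  (\<Oplus>\<^bsub>P\<^esub>x\<in>Poly_Mapping.keys c. [Poly_Mapping.lookup c x] \<cdot>\<^bsub>P\<^esub> h (fst x) (snd x))"

lemma free_lift_hom: "group_hom F (add_monoid P) free_lift"
proof -
  \<comment> \<open>Written multiplicatively in \<open>add_monoid P\<close>, the sum of multiples is
    the product treated by \<open>free_Abelian_group_lift_hom\<close>.\<close>
  have "free_lift \<in> hom F (add_monoid P)"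
    using P.a_comm_group h
    unfolding free_lift_def[abs_def] finsum_def add_pow_def
    by (intro comm_group.free_Abelian_group_lift_hom) (auto simp: balanced_def)
  then show ?thesis
    using P.a_group F.is_group by (simp add: group_hom_def group_hom_axioms_def)
qed

interpretation free_lift: group_hom F "add_monoid P" free_lift by (rule free_lift_hom)

lemma free_lift_frag_of: "\<lbrakk>m \<in> carrier M; n \<in> carrier N\<rbrakk> \<Longrightarrow> free_lift (frag_of (m, n)) = h m n"
  using h by (simp add: free_lift_def balanced_def)

lemmas free_lift_diff = P.free_Abelian_group_hom_diff[OF free_lift_hom]

text \<open>The kernel of a homomorphism is a subgroup, so the generators suffice. Each of the three
  families of relations is killed by the matching equation in \<open>balanced\<close>.\<close>

lemma free_lift_kernel: "c \<in> tensor_kernel S M N \<Longrightarrow> free_lift c = \<zero>\<^bsub>P\<^esub>"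
proof -
  have "tensor_relations S M N \<subseteq> kernel F (add_monoid P) free_lift"
  proof
    fix r assume r: "r \<in> tensor_relations S M N"
    then have rF: "r \<in> carrier F" using tensor_relations_subset by blast
    have h': "h m n \<in> carrier P" if "m \<in> carrier M" "n \<in> carrier N" for m n
      using h that by (auto simp: balanced_def)
    from r have "free_lift r = \<zero>\<^bsub>P\<^esub>"
      unfolding tensor_relations_def
    proof (elim UnE CollectE exE conjE)
      fix m m' n
      assume "r = frag_of (m \<oplus>\<^bsub>M\<^esub> m', n) - frag_of (m, n) - frag_of (m', n)"
        and mn: "m \<in> carrier M" "m' \<in> carrier M" "n \<in> carrier N"
      \<comment> \<open>Regrouped as a single difference of elements of \<open>F\<close>, the
        relation has the form required by \<open>free_lift_diff\<close>.\<close>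
      then have "r = frag_of (m \<oplus>\<^bsub>M\<^esub> m', n) - (frag_of (m, n) \<otimes>\<^bsub>F\<^esub> frag_of (m', n))"
        by (simp add: diff_diff_eq)
      then have "free_lift r = free_lift (frag_of (m \<oplus>\<^bsub>M\<^esub> m', n)) \<ominus>\<^bsub>P\<^esub>
          free_lift (frag_of (m, n) \<otimes>\<^bsub>F\<^esub> frag_of (m', n))"
        using mn by (simp only:) (intro free_lift_diff F.m_closed; simp)
      also have "\<dots> = h (m \<oplus>\<^bsub>M\<^esub> m') n \<ominus>\<^bsub>P\<^esub> (h m n \<oplus>\<^bsub>P\<^esub> h m' n)"
        using mn by (subst free_lift.hom_mult) (auto simp: free_lift_frag_of)
      also have "\<dots> = \<zero>\<^bsub>P\<^esub>"
        using h mn h' by (simp add: balanced_def P.r_neg a_minus_def)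
      finally show ?thesis .
    next
      fix m n n'
      assume "r = frag_of (m, n \<oplus>\<^bsub>N\<^esub> n') - frag_of (m, n) - frag_of (m, n')"
        and mn: "m \<in> carrier M" "n \<in> carrier N" "n' \<in> carrier N"
      then have "r = frag_of (m, n \<oplus>\<^bsub>N\<^esub> n') - (frag_of (m, n) \<otimes>\<^bsub>F\<^esub> frag_of (m, n'))"
        by (simp add: diff_diff_eq)
      then have "free_lift r = free_lift (frag_of (m, n \<oplus>\<^bsub>N\<^esub> n')) \<ominus>\<^bsub>P\<^esub>
          free_lift (frag_of (m, n) \<otimes>\<^bsub>F\<^esub> frag_of (m, n'))"
        using mn by (simp only:) (intro free_lift_diff F.m_closed; simp)
      also have "\<dots> = h m (n \<oplus>\<^bsub>N\<^esub> n') \<ominus>\<^bsub>P\<^esub> (h m n \<oplus>\<^bsub>P\<^esub> h m n')"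
        using mn by (subst free_lift.hom_mult) (auto simp: free_lift_frag_of)
      also have "\<dots> = \<zero>\<^bsub>P\<^esub>"
        using h mn h' by (simp add: balanced_def P.r_neg a_minus_def)
      finally show ?thesis .
    next
      fix m s n
      assume r: "r = frag_of (m \<triangleleft>\<^bsub>M\<^esub> s, n) - frag_of (m, s \<triangleright>\<^bsub>N\<^esub> n)"
        and mn: "m \<in> carrier M" "s \<in> carrier S" "n \<in> carrier N"
      have "free_lift r = h (m \<triangleleft>\<^bsub>M\<^esub> s) n \<ominus>\<^bsub>P\<^esub> h m (s \<triangleright>\<^bsub>N\<^esub> n)"
        unfolding r using mn M_ract_closed N_lact_closed
        by (subst free_lift_diff) (auto simp: free_lift_frag_of)
      also have "\<dots> = \<zero>\<^bsub>P\<^esub>"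
        using h mn h' M_ract_closed N_lact_closed by (simp add: balanced_def P.r_neg a_minus_def)
      finally show ?thesis .
    qed
    with rF show "r \<in> kernel F (add_monoid P) free_lift" by (simp add: kernel_def)
  qed
  then have "tensor_kernel S M N \<subseteq> kernel F (add_monoid P) free_lift"
    unfolding tensor_kernel_def by (rule F.generate_subgroup_incl[OF _ free_lift.subgroup_kernel])
  then show "c \<in> tensor_kernel S M N \<Longrightarrow> free_lift c = \<zero>\<^bsub>P\<^esub>" by (auto simp: kernel_def)
qed

text \<open>Representatives of a coset differ by an element of the kernel, which
  \<open>free_lift\<close> kills. The set of values in \<open>tensor_lift\<close> is thus a
  singleton, which gives \<open>the_elem\<close> its meaning.\<close>

lemma tensor_lift_proj:
  assumes c: "c \<in> carrier F"
  shows "tensor_lift P h (proj c) = free_lift c"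
proof -
  have "free_lift d = free_lift c" if d: "d \<in> proj c" for d
  proof -
    obtain k where k: "k \<in> tensor_kernel S M N" "d = k \<otimes>\<^bsub>F\<^esub> c"
      using d unfolding r_coset_def by blast
    have "k \<in> carrier F" using k(1) kernel.subset by blast
    then have "free_lift d = free_lift k \<oplus>\<^bsub>P\<^esub> free_lift c"
      unfolding k(2) using free_lift.hom_mult[OF _ c] by simp
    then show ?thesis
      using free_lift.hom_closed[OF c] by (simp add: free_lift_kernel[OF k(1)])
  qed
  moreover have "c \<in> proj c" using F.rcos_self[OF c kernel.subgroup_axioms] .
  ultimately have "free_lift ` proj c = {free_lift c}" by blast
  then show ?thesis unfolding tensor_lift_def free_lift_def[abs_def] by simp
qed

lemma tensor_lift_hom: "tensor_lift P h \<in> hom (tensor_group S M N) (add_monoid P)"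
proof (rule homI)
  fix t assume "t \<in> carrier (tensor_group S M N)"
  then obtain c where "c \<in> carrier F" "t = proj c" by (rule tensor_cases)
  then show "tensor_lift P h t \<in> carrier (add_monoid P)"
    by (metis tensor_lift_proj free_lift.hom_closed)
next
  fix t u assume "t \<in> carrier (tensor_group S M N)" "u \<in> carrier (tensor_group S M N)"
  then obtain c d where cd: "c \<in> carrier F" "t = proj c" "d \<in> carrier F" "u = proj d"
    by (elim tensor_cases) blast
  have "t \<otimes>\<^bsub>tensor_group S M N\<^esub> u = proj (c \<otimes>\<^bsub>F\<^esub> d)"
    unfolding cd(2,4) by (rule hom_mult[OF proj_hom cd(1,3), symmetric])
  then show "tensor_lift P h (t \<otimes>\<^bsub>tensor_group S M N\<^esub> u) =
      tensor_lift P h t \<otimes>\<^bsub>add_monoid P\<^esub> tensor_lift P h u"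
    unfolding cd(2,4)
    by (simp only: tensor_lift_proj cd(1,3) F.m_closed free_lift.hom_mult)
qed

lemma tensor_lift_pure:
  assumes "m \<in> carrier M" and "n \<in> carrier N"
  shows "tensor_lift P h (pure_tensor S M N m n) = h m n"
  using assms tensor_lift_proj[of "frag_of (m, n)"] by (simp add: pure_tensor_def free_lift_frag_of)

end

end


section \<open>Duals of finite-dimensional vector spaces\<close>

definition spans :: "('k, 'x) ring_scheme \<Rightarrow> ('k, 'v, 'y) module_scheme \<Rightarrow> 'v set \<Rightarrow> bool" where
  "spans K V S \<longleftrightarrow> finite S \<and> S \<subseteq> carrier V \<and>
     (\<forall>v\<in>carrier V. \<exists>c\<in>S \<rightarrow> carrier K. v = (\<Oplus>\<^bsub>V\<^esub>s\<in>S. c s \<odot>\<^bsub>V\<^esub> s))"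

locale vector_space = K: field K + module K V for K (structure) and V (structure)
begin

text \<open>If two families of coefficients for the same vector differed at \<open>s0\<close>, one
  could solve for \<open>s0\<close> in terms of the other vectors. Then \<open>S - {s0}\<close>
  would span, against minimality.\<close>

lemma minimal_spanning_set_independent:
  assumes S: "spans K V S"
    and min: "\<And>T. spans K V T \<Longrightarrow> card S \<le> card T"
    and c: "c \<in> S \<rightarrow> carrier K" and d: "d \<in> S \<rightarrow> carrier K"
    and eq: "(\<Oplus>\<^bsub>V\<^esub>s\<in>S. c s \<odot>\<^bsub>V\<^esub> s) = (\<Oplus>\<^bsub>V\<^esub>s\<in>S. d s \<odot>\<^bsub>V\<^esub> s)"
    and s0: "s0 \<in> S"
  shows "c s0 = d s0"
proof (rule ccontr)
  assume neq: "c s0 \<noteq> d s0"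
  have fin: "finite S" and sub: "\<And>s. s \<in> S \<Longrightarrow> s \<in> carrier V"
    using S by (auto simp: spans_def)
  define T where "T = S - {s0}"
  have ST: "S = insert s0 T" "s0 \<notin> T" "finite T" "T \<subseteq> S"
    using s0 fin by (auto simp: T_def)
  have cK: "\<And>s. s \<in> S \<Longrightarrow> c s \<in> carrier K" and dK: "\<And>s. s \<in> S \<Longrightarrow> d s \<in> carrier K"
    using c d by auto
  define u where "u = inv\<^bsub>K\<^esub> (c s0 \<ominus>\<^bsub>K\<^esub> d s0)"
  have "c s0 \<ominus>\<^bsub>K\<^esub> d s0 \<noteq> \<zero>\<^bsub>K\<^esub>"
  proof
    assume "c s0 \<ominus>\<^bsub>K\<^esub> d s0 = \<zero>\<^bsub>K\<^esub>"
    then have "c s0 = \<ominus>\<^bsub>K\<^esub> (\<ominus>\<^bsub>K\<^esub> d s0)"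
      using s0 cK dK by (intro K.minus_equality[symmetric]) (auto simp: a_minus_def)
    then show False using neq s0 dK by simp
  qed
  then have unit: "c s0 \<ominus>\<^bsub>K\<^esub> d s0 \<in> Units K"
    using s0 cK dK by (simp add: K.field_Units)
  then have uK: "u \<in> carrier K" and u1: "u \<otimes>\<^bsub>K\<^esub> (c s0 \<ominus>\<^bsub>K\<^esub> d s0) = \<one>\<^bsub>K\<^esub>"
    by (simp_all add: u_def)
  \<comment> \<open>\<open>C\<close> and \<open>D\<close> are the two linear combinations with their
    \<open>s0\<close> terms removed; solving for \<open>s0\<close> will give \<open>u\<close> times
    \<open>D - C\<close>.\<close>
  define C where "C = (\<Oplus>\<^bsub>V\<^esub>s\<in>T. c s \<odot>\<^bsub>V\<^esub> s)"
  define D where "D = (\<Oplus>\<^bsub>V\<^esub>s\<in>T. d s \<odot>\<^bsub>V\<^esub> s)"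
  have TV: "\<And>s. s \<in> T \<Longrightarrow> s \<in> carrier V" using sub ST(4) by auto
  have CV: "C \<in> carrier V" and DV: "D \<in> carrier V"
    unfolding C_def D_def using TV cK dK ST(4) by (auto intro!: M.finsum_closed)
  have s0V: "s0 \<in> carrier V" using s0 sub by simp
  have expand: "(\<Oplus>\<^bsub>V\<^esub>s\<in>S. b s \<odot>\<^bsub>V\<^esub> s) = b s0 \<odot>\<^bsub>V\<^esub> s0 \<oplus>\<^bsub>V\<^esub> (\<Oplus>\<^bsub>V\<^esub>s\<in>T. b s \<odot>\<^bsub>V\<^esub> s)"
    if "\<And>s. s \<in> S \<Longrightarrow> b s \<in> carrier K" for b
    unfolding ST(1) by (rule M.finsum_insert) (use ST TV that s0V in auto)
  have e1: "c s0 \<odot>\<^bsub>V\<^esub> s0 \<oplus>\<^bsub>V\<^esub> C = d s0 \<odot>\<^bsub>V\<^esub> s0 \<oplus>\<^bsub>V\<^esub> D"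
    using eq expand[of c] expand[of d] cK dK by (simp add: C_def D_def)
  have cs: "c s0 \<odot>\<^bsub>V\<^esub> s0 \<in> carrier V" "d s0 \<odot>\<^bsub>V\<^esub> s0 \<in> carrier V"
    using s0 s0V cK dK by auto
  have "(c s0 \<ominus>\<^bsub>K\<^esub> d s0) \<odot>\<^bsub>V\<^esub> s0 = c s0 \<odot>\<^bsub>V\<^esub> s0 \<ominus>\<^bsub>V\<^esub> d s0 \<odot>\<^bsub>V\<^esub> s0"
    using s0 s0V cK dK by (simp add: a_minus_def smult_l_distr smult_l_minus)
  also have "\<dots> = (c s0 \<odot>\<^bsub>V\<^esub> s0 \<oplus>\<^bsub>V\<^esub> C) \<ominus>\<^bsub>V\<^esub> (d s0 \<odot>\<^bsub>V\<^esub> s0 \<oplus>\<^bsub>V\<^esub> C)"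
    using cs CV by (simp add: a_minus_def M.minus_add M.a_ac M.r_neg M.r_neg1 M.r_neg2)
  also have "\<dots> = D \<ominus>\<^bsub>V\<^esub> C"
    unfolding e1 using cs CV DV by (simp add: a_minus_def M.minus_add M.a_ac M.r_neg M.r_neg1 M.r_neg2)
  finally have "u \<odot>\<^bsub>V\<^esub> ((c s0 \<ominus>\<^bsub>K\<^esub> d s0) \<odot>\<^bsub>V\<^esub> s0) = u \<odot>\<^bsub>V\<^esub> (D \<ominus>\<^bsub>V\<^esub> C)"
    by simp
  then have s0_eq: "s0 = u \<odot>\<^bsub>V\<^esub> (D \<ominus>\<^bsub>V\<^esub> C)"
    using uK u1 s0 s0V cK dK by (simp flip: smult_assoc1)
  \<comment> \<open>The coefficients of \<open>s0\<close> with respect to \<open>T\<close>.\<close>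
  define b where "b s = u \<otimes>\<^bsub>K\<^esub> (d s \<ominus>\<^bsub>K\<^esub> c s)" for s
  have bK: "\<And>s. s \<in> T \<Longrightarrow> b s \<in> carrier K" using uK cK dK ST(4) by (auto simp: b_def)
  have "D \<ominus>\<^bsub>V\<^esub> C = (\<Oplus>\<^bsub>V\<^esub>s\<in>T. (d s \<ominus>\<^bsub>K\<^esub> c s) \<odot>\<^bsub>V\<^esub> s)"
  proof -
    \<comment> \<open>Adding \<open>C\<close> to the right-hand side of the claim avoids sums of
      negatives.\<close>
    have "(\<Oplus>\<^bsub>V\<^esub>s\<in>T. (d s \<ominus>\<^bsub>K\<^esub> c s) \<odot>\<^bsub>V\<^esub> s) \<oplus>\<^bsub>V\<^esub> C =
        (\<Oplus>\<^bsub>V\<^esub>s\<in>T. (d s \<ominus>\<^bsub>K\<^esub> c s) \<odot>\<^bsub>V\<^esub> s \<oplus>\<^bsub>V\<^esub> c s \<odot>\<^bsub>V\<^esub> s)"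
      unfolding C_def using TV cK dK ST(4)
      by (intro M.finsum_addf[symmetric]) (auto intro!: smult_closed)
    also have "\<dots> = D"
      unfolding D_def
    proof (rule M.finsum_cong')
      fix s assume s: "s \<in> T"
      have "(d s \<ominus>\<^bsub>K\<^esub> c s) \<odot>\<^bsub>V\<^esub> s \<oplus>\<^bsub>V\<^esub> c s \<odot>\<^bsub>V\<^esub> s = ((d s \<ominus>\<^bsub>K\<^esub> c s) \<oplus>\<^bsub>K\<^esub> c s) \<odot>\<^bsub>V\<^esub> s"
        using s TV cK dK ST(4) by (subst smult_l_distr) auto
      also have "(d s \<ominus>\<^bsub>K\<^esub> c s) \<oplus>\<^bsub>K\<^esub> c s = d s"
        using s cK[of s] dK[of s] ST(4) by (auto simp: a_minus_def K.a_assoc K.l_neg)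
      finally show "(d s \<ominus>\<^bsub>K\<^esub> c s) \<odot>\<^bsub>V\<^esub> s \<oplus>\<^bsub>V\<^esub> c s \<odot>\<^bsub>V\<^esub> s = d s \<odot>\<^bsub>V\<^esub> s" .
    qed (use TV dK ST(4) in auto)
    finally have "D = (\<Oplus>\<^bsub>V\<^esub>s\<in>T. (d s \<ominus>\<^bsub>K\<^esub> c s) \<odot>\<^bsub>V\<^esub> s) \<oplus>\<^bsub>V\<^esub> C" ..
    moreover have "(\<Oplus>\<^bsub>V\<^esub>s\<in>T. (d s \<ominus>\<^bsub>K\<^esub> c s) \<odot>\<^bsub>V\<^esub> s) \<in> carrier V"
      using TV cK dK ST(4) by (auto intro!: M.finsum_closed smult_closed)
    ultimately show ?thesis
      using CV by (simp add: a_minus_def M.a_assoc M.r_neg)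
  qed
  then have "s0 = u \<odot>\<^bsub>V\<^esub> (\<Oplus>\<^bsub>V\<^esub>s\<in>T. (d s \<ominus>\<^bsub>K\<^esub> c s) \<odot>\<^bsub>V\<^esub> s)"
    using s0_eq by simp
  also have "\<dots> = (\<Oplus>\<^bsub>V\<^esub>s\<in>T. u \<odot>\<^bsub>V\<^esub> ((d s \<ominus>\<^bsub>K\<^esub> c s) \<odot>\<^bsub>V\<^esub> s))"
    using TV cK dK ST(4) uK by (intro finsum_smult_ldistr[OF ST(3)]) auto
  also have "\<dots> = (\<Oplus>\<^bsub>V\<^esub>s\<in>T. b s \<odot>\<^bsub>V\<^esub> s)"
    unfolding b_def using TV cK dK ST(4) uK
    by (intro M.finsum_cong') (auto simp: smult_assoc1 intro!: smult_closed)
  finally have s0b: "s0 = (\<Oplus>\<^bsub>V\<^esub>s\<in>T. b s \<odot>\<^bsub>V\<^esub> s)" .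
  have "spans K V T"
    unfolding spans_def
  proof (intro conjI ballI)
    fix v assume "v \<in> carrier V"
    then obtain a where a: "a \<in> S \<rightarrow> carrier K" "v = (\<Oplus>\<^bsub>V\<^esub>s\<in>S. a s \<odot>\<^bsub>V\<^esub> s)"
      using S unfolding spans_def by blast
    have aK: "\<And>s. s \<in> S \<Longrightarrow> a s \<in> carrier K" using a by auto
    \<comment> \<open>In an expansion of \<open>v\<close> over \<open>S\<close>, the vector
      \<open>s0\<close> is replaced by its expansion over \<open>T\<close>.\<close>
    have "v = a s0 \<odot>\<^bsub>V\<^esub> (\<Oplus>\<^bsub>V\<^esub>s\<in>T. b s \<odot>\<^bsub>V\<^esub> s) \<oplus>\<^bsub>V\<^esub> (\<Oplus>\<^bsub>V\<^esub>s\<in>T. a s \<odot>\<^bsub>V\<^esub> s)"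
      unfolding a(2) using expand[OF aK] s0b by simp
    also have "a s0 \<odot>\<^bsub>V\<^esub> (\<Oplus>\<^bsub>V\<^esub>s\<in>T. b s \<odot>\<^bsub>V\<^esub> s) = (\<Oplus>\<^bsub>V\<^esub>s\<in>T. a s0 \<odot>\<^bsub>V\<^esub> (b s \<odot>\<^bsub>V\<^esub> s))"
      using aK s0 bK TV ST(3) by (intro finsum_smult_ldistr) auto
    also have "\<dots> \<oplus>\<^bsub>V\<^esub> (\<Oplus>\<^bsub>V\<^esub>s\<in>T. a s \<odot>\<^bsub>V\<^esub> s) =
        (\<Oplus>\<^bsub>V\<^esub>s\<in>T. a s0 \<odot>\<^bsub>V\<^esub> (b s \<odot>\<^bsub>V\<^esub> s) \<oplus>\<^bsub>V\<^esub> a s \<odot>\<^bsub>V\<^esub> s)"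
      using aK s0 bK TV ST(4) by (intro M.finsum_addf[symmetric]) auto
    also have "\<dots> = (\<Oplus>\<^bsub>V\<^esub>s\<in>T. (a s0 \<otimes>\<^bsub>K\<^esub> b s \<oplus>\<^bsub>K\<^esub> a s) \<odot>\<^bsub>V\<^esub> s)"
      using aK s0 bK TV ST(4)
      by (intro M.finsum_cong') (auto simp: smult_assoc1 smult_l_distr subset_iff)
    finally show "\<exists>c\<in>T \<rightarrow> carrier K. v = (\<Oplus>\<^bsub>V\<^esub>s\<in>T. c s \<odot>\<^bsub>V\<^esub> s)"
      using aK s0 bK ST(4) by (intro bexI[of _ "\<lambda>s. a s0 \<otimes>\<^bsub>K\<^esub> b s \<oplus>\<^bsub>K\<^esub> a s"]) auto
  qed (use ST TV in auto)
  then have "card S \<le> card T" by (rule min)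
  then show False using ST by simp
qed

text \<open>Reusing \<open>dual_bimodule\<close> lets the results below apply verbatim to
  \<open>D(A)\<close> when \<open>V\<close> is the algebra \<open>A\<close>.\<close>

abbreviation "D \<equiv> dual_bimodule K V"

lemma dual_carrier_iff:
  "f \<in> carrier D \<longleftrightarrow> f \<in> carrier V \<rightarrow>\<^sub>E carrier K \<and>
     (\<forall>x\<in>carrier V. \<forall>y\<in>carrier V. f (x \<oplus>\<^bsub>V\<^esub> y) = f x \<oplus>\<^bsub>K\<^esub> f y) \<and>
     (\<forall>k\<in>carrier K. \<forall>x\<in>carrier V. f (k \<odot>\<^bsub>V\<^esub> x) = k \<otimes>\<^bsub>K\<^esub> f x)"
  by (simp add: dual_bimodule_def)

text \<open>In a spanning set of least size the coefficients of a vector are unique. Sums and scalar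
  multiples of coefficients represent sums and scalar multiples of vectors, so uniqueness makes each
  coefficient a linear functional.\<close>

lemma dual_basis:
  assumes "finite_dim K V"
  obtains S w where "finite S" and "S \<subseteq> carrier V" and "\<And>s. s \<in> S \<Longrightarrow> w s \<in> carrier D"
    and "\<And>v. v \<in> carrier V \<Longrightarrow> v = (\<Oplus>\<^bsub>V\<^esub>s\<in>S. w s v \<odot>\<^bsub>V\<^esub> s)"
proof -
  obtain S0 where "spans K V S0" using assms unfolding finite_dim_def spans_def by blast
  then obtain S where S: "spans K V S" and min: "\<And>T. spans K V T \<Longrightarrow> card S \<le> card T"
    using ex_has_least_nat[of "spans K V" S0 card] by blast
  have fin: "finite S" and sub: "S \<subseteq> carrier V" using S by (auto simp: spans_def)
  obtain coef where coef: "\<And>v. v \<in> carrier V \<Longrightarrow> coef v \<in> S \<rightarrow> carrier K"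
    "\<And>v. v \<in> carrier V \<Longrightarrow> v = (\<Oplus>\<^bsub>V\<^esub>s\<in>S. coef v s \<odot>\<^bsub>V\<^esub> s)"
    using S unfolding spans_def by metis
  have coefK: "\<And>v s. v \<in> carrier V \<Longrightarrow> s \<in> S \<Longrightarrow> coef v s \<in> carrier K"
    using coef(1) by auto
  have uniq: "coef v s = c s"
    if "v \<in> carrier V" "\<And>s. s \<in> S \<Longrightarrow> c s \<in> carrier K" "s \<in> S" "v = (\<Oplus>\<^bsub>V\<^esub>s\<in>S. c s \<odot>\<^bsub>V\<^esub> s)"
    for v c s
    by (rule minimal_spanning_set_independent[OF S min coef(1)[OF that(1)] _
          trans[OF coef(2)[OF that(1), symmetric] that(4)] that(3)])
      (use that(2) in auto)
  define w where "w s = (\<lambda>v\<in>carrier V. coef v s)" for s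
  show thesis
  proof (rule that[OF fin sub])
    fix s assume s: "s \<in> S"
    have "coef (x \<oplus>\<^bsub>V\<^esub> y) s = coef x s \<oplus>\<^bsub>K\<^esub> coef y s"
      if "x \<in> carrier V" "y \<in> carrier V" for x y
    proof (rule uniq[OF _ _ s])
      have "x \<oplus>\<^bsub>V\<^esub> y = (\<Oplus>\<^bsub>V\<^esub>s\<in>S. coef x s \<odot>\<^bsub>V\<^esub> s) \<oplus>\<^bsub>V\<^esub> (\<Oplus>\<^bsub>V\<^esub>s\<in>S. coef y s \<odot>\<^bsub>V\<^esub> s)"
        by (rule arg_cong2[where f = "add V"]; rule coef(2); fact that)
      also have "\<dots> = (\<Oplus>\<^bsub>V\<^esub>s\<in>S. coef x s \<odot>\<^bsub>V\<^esub> s \<oplus>\<^bsub>V\<^esub> coef y s \<odot>\<^bsub>V\<^esub> s)"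
        using that coefK sub by (intro M.finsum_addf[symmetric]) auto
      also have "\<dots> = (\<Oplus>\<^bsub>V\<^esub>s\<in>S. (coef x s \<oplus>\<^bsub>K\<^esub> coef y s) \<odot>\<^bsub>V\<^esub> s)"
        using that coefK sub by (intro M.finsum_cong') (auto simp: smult_l_distr subset_iff)
      finally show "x \<oplus>\<^bsub>V\<^esub> y = (\<Oplus>\<^bsub>V\<^esub>s\<in>S. (coef x s \<oplus>\<^bsub>K\<^esub> coef y s) \<odot>\<^bsub>V\<^esub> s)" .
    qed (use that coefK in auto)
    moreover have "coef (k \<odot>\<^bsub>V\<^esub> x) s = k \<otimes>\<^bsub>K\<^esub> coef x s"
      if "k \<in> carrier K" "x \<in> carrier V" for k x
    proof (rule uniq[OF _ _ s])
      have "k \<odot>\<^bsub>V\<^esub> x = k \<odot>\<^bsub>V\<^esub> (\<Oplus>\<^bsub>V\<^esub>s\<in>S. coef x s \<odot>\<^bsub>V\<^esub> s)"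
        by (rule arg_cong[OF coef(2)[OF that(2)]])
      also have "\<dots> = (\<Oplus>\<^bsub>V\<^esub>s\<in>S. k \<odot>\<^bsub>V\<^esub> (coef x s \<odot>\<^bsub>V\<^esub> s))"
        using that coefK sub fin by (intro finsum_smult_ldistr) auto
      also have "\<dots> = (\<Oplus>\<^bsub>V\<^esub>s\<in>S. (k \<otimes>\<^bsub>K\<^esub> coef x s) \<odot>\<^bsub>V\<^esub> s)"
        using that coefK sub by (intro M.finsum_cong') (auto simp: smult_assoc1 subset_iff)
      finally show "k \<odot>\<^bsub>V\<^esub> x = (\<Oplus>\<^bsub>V\<^esub>s\<in>S. (k \<otimes>\<^bsub>K\<^esub> coef x s) \<odot>\<^bsub>V\<^esub> s)" .
    qed (use that coefK in auto)
    ultimately show "w s \<in> carrier D"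
      using s coefK by (auto simp: dual_carrier_iff w_def)
  next
    fix v assume v: "v \<in> carrier V"
    have "(\<Oplus>\<^bsub>V\<^esub>s\<in>S. w s v \<odot>\<^bsub>V\<^esub> s) = (\<Oplus>\<^bsub>V\<^esub>s\<in>S. coef v s \<odot>\<^bsub>V\<^esub> s)"
      using v by (simp add: w_def)
    with coef(2)[OF v] show "v = (\<Oplus>\<^bsub>V\<^esub>s\<in>S. w s v \<odot>\<^bsub>V\<^esub> s)"
      by (rule trans[OF _ sym])
  qed
qed

section \<open>Separation by functionals and the double dual\<close>

lemma dual_finsum:
  assumes f: "f \<in> carrier D" and "finite T" and "T \<subseteq> carrier V"
    and "\<And>s. s \<in> T \<Longrightarrow> c s \<in> carrier K"
  shows "f (\<Oplus>\<^bsub>V\<^esub>s\<in>T. c s \<odot>\<^bsub>V\<^esub> s) = (\<Oplus>\<^bsub>K\<^esub>s\<in>T. c s \<otimes>\<^bsub>K\<^esub> f s)"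
  using assms(2-)
proof (induction T rule: finite_induct)
  case empty
  have fK: "f \<zero>\<^bsub>V\<^esub> \<in> carrier K" using f by (auto simp: dual_carrier_iff)
  \<comment> \<open>Homogeneity at the scalar zero shows that \<open>f\<close> preserves
    zero.\<close>
  have "f (\<zero>\<^bsub>K\<^esub> \<odot>\<^bsub>V\<^esub> \<zero>\<^bsub>V\<^esub>) = \<zero>\<^bsub>K\<^esub> \<otimes>\<^bsub>K\<^esub> f \<zero>\<^bsub>V\<^esub>"
    using f K.zero_closed M.zero_closed unfolding dual_carrier_iff by blast
  then show ?case using fK by simp
next
  case (insert s T)
  have fK: "\<And>x. x \<in> carrier V \<Longrightarrow> f x \<in> carrier K" using f by (auto simp: dual_carrier_iff)
  have "(\<Oplus>\<^bsub>V\<^esub>s\<in>insert s T. c s \<odot>\<^bsub>V\<^esub> s) = c s \<odot>\<^bsub>V\<^esub> s \<oplus>\<^bsub>V\<^esub> (\<Oplus>\<^bsub>V\<^esub>s\<in>T. c s \<odot>\<^bsub>V\<^esub> s)"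
    using insert by (intro M.finsum_insert) auto
  moreover have "(\<Oplus>\<^bsub>V\<^esub>s\<in>T. c s \<odot>\<^bsub>V\<^esub> s) \<in> carrier V"
    using insert by (intro M.finsum_closed) auto
  moreover have "(\<Oplus>\<^bsub>K\<^esub>s\<in>insert s T. c s \<otimes>\<^bsub>K\<^esub> f s) = c s \<otimes>\<^bsub>K\<^esub> f s \<oplus>\<^bsub>K\<^esub> (\<Oplus>\<^bsub>K\<^esub>s\<in>T. c s \<otimes>\<^bsub>K\<^esub> f s)"
    using insert fK by (intro K.finsum_insert) auto
  ultimately show ?case
    using f insert by (simp add: dual_carrier_iff)
qed

text \<open>The coordinates of a vector in a dual basis are values of functionals, and they
  determine the vector.\<close>

lemma dual_separates:
  assumes "finite_dim K V" and x: "x \<in> carrier V" and y: "y \<in> carrier V"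
    and eq: "\<And>f. f \<in> carrier D \<Longrightarrow> f x = f y"
  shows "x = y"
proof -
  obtain S w where Sw: "finite S" "S \<subseteq> carrier V" "\<And>s. s \<in> S \<Longrightarrow> w s \<in> carrier D"
    "\<And>v. v \<in> carrier V \<Longrightarrow> v = (\<Oplus>\<^bsub>V\<^esub>s\<in>S. w s v \<odot>\<^bsub>V\<^esub> s)"
    by (rule dual_basis[OF assms(1)]) (rule that; assumption)
  have wK: "w s v \<in> carrier K" if "s \<in> S" "v \<in> carrier V" for s v
    using Sw(3)[OF that(1)] that(2) by (auto simp: dual_carrier_iff)
  have "(\<Oplus>\<^bsub>V\<^esub>s\<in>S. w s x \<odot>\<^bsub>V\<^esub> s) = (\<Oplus>\<^bsub>V\<^esub>s\<in>S. w s y \<odot>\<^bsub>V\<^esub> s)"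
    using Sw(2) wK y by (intro M.finsum_cong') (auto simp: eq[OF Sw(3)])
  from trans[OF Sw(4)[OF x] this] show ?thesis
    unfolding Sw(4)[OF y, symmetric] .
qed

text \<open>Surjectivity of the map from \<open>V\<close> to its double dual. In a dual basis
  \<open>f\<close> is the sum of the \<open>f s\<close> times \<open>w s\<close>, so \<Phi> f is the
  sum of the \<open>f s\<close> times \<Phi>(\<open>w s\<close>), which is the value of
  \<open>f\<close> at the sum of the \<Phi>(\<open>w s\<close>) times \<open>s\<close>.\<close>

lemma double_dual:
  assumes "finite_dim K V"
    and closed: "\<And>f. f \<in> carrier D \<Longrightarrow> \<Phi> f \<in> carrier K"
    and add: "\<And>f g. \<lbrakk>f \<in> carrier D; g \<in> carrier D\<rbrakk> \<Longrightarrow> \<Phi> (f \<oplus>\<^bsub>D\<^esub> g) = \<Phi> f \<oplus>\<^bsub>K\<^esub> \<Phi> g"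
    and scale: "\<And>k f. \<lbrakk>k \<in> carrier K; f \<in> carrier D\<rbrakk> \<Longrightarrow>
      \<Phi> (\<lambda>v\<in>carrier V. k \<otimes>\<^bsub>K\<^esub> f v) = k \<otimes>\<^bsub>K\<^esub> \<Phi> f"
  obtains a where "a \<in> carrier V" and "\<And>f. f \<in> carrier D \<Longrightarrow> \<Phi> f = f a"
proof -
  obtain S w where Sw: "finite S" "S \<subseteq> carrier V" "\<And>s. s \<in> S \<Longrightarrow> w s \<in> carrier D"
    "\<And>v. v \<in> carrier V \<Longrightarrow> v = (\<Oplus>\<^bsub>V\<^esub>s\<in>S. w s v \<odot>\<^bsub>V\<^esub> s)"
    by (rule dual_basis[OF assms(1)]) (rule that; assumption)
  have dualK: "f v \<in> carrier K" if "f \<in> carrier D" "v \<in> carrier V" for f v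
    using that by (auto simp: dual_carrier_iff)
  define a where "a = (\<Oplus>\<^bsub>V\<^esub>s\<in>S. \<Phi> (w s) \<odot>\<^bsub>V\<^esub> s)"
  have "\<Phi> f = f a" if f: "f \<in> carrier D" for f
  proof -
    \<comment> \<open>Partial sums of the dual basis expansion of \<open>f\<close>, formed pointwise
      in \<open>K\<close>; induction on \<open>T\<close> yields both membership in \<open>D\<close>
      and the value of \<Phi>.\<close>
    define g where "g T = (\<lambda>v\<in>carrier V. \<Oplus>\<^bsub>K\<^esub>s\<in>T. f s \<otimes>\<^bsub>K\<^esub> w s v)" for T
    have g: "g T \<in> carrier D \<and> \<Phi> (g T) = (\<Oplus>\<^bsub>K\<^esub>s\<in>T. f s \<otimes>\<^bsub>K\<^esub> \<Phi> (w s))"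
      if "finite T" "T \<subseteq> S" for T
      using that
    proof (induction T rule: finite_induct)
      case empty
      have zero: "(\<lambda>v\<in>carrier V. \<zero>\<^bsub>K\<^esub>) \<in> carrier D" by (auto simp: dual_carrier_iff)
      have "\<Phi> (\<lambda>v\<in>carrier V. \<zero>\<^bsub>K\<^esub> \<otimes>\<^bsub>K\<^esub> f v) = \<zero>\<^bsub>K\<^esub> \<otimes>\<^bsub>K\<^esub> \<Phi> f"
        by (rule scale) (use f in auto)
      moreover have "(\<lambda>v\<in>carrier V. \<zero>\<^bsub>K\<^esub> \<otimes>\<^bsub>K\<^esub> f v) = (\<lambda>v\<in>carrier V. \<zero>\<^bsub>K\<^esub>)"
        using f dualK by (intro restrict_ext) simp
      moreover have "g {} = (\<lambda>v\<in>carrier V. \<zero>\<^bsub>K\<^esub>)" by (simp add: g_def)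
      ultimately show ?case using zero closed[OF f] by (simp del: restrict_apply)
    next
      case (insert s T)
      have s: "s \<in> S" "s \<in> carrier V" "w s \<in> carrier D" using insert Sw(2,3) by auto
      have TS: "\<And>t. t \<in> T \<Longrightarrow> t \<in> carrier V \<and> w t \<in> carrier D" using insert Sw(2,3) by auto
      define h where "h = (\<lambda>v\<in>carrier V. f s \<otimes>\<^bsub>K\<^esub> w s v)"
      have wsK: "\<And>v. v \<in> carrier V \<Longrightarrow> w s v \<in> carrier K" using s dualK by blast
      have fs: "f s \<in> carrier K" using f s dualK by blast
      have h: "h \<in> carrier D"
        using s(3) fs wsK unfolding dual_carrier_iff h_def
        by (auto simp: K.r_distr K.m_lcomm)
      have split: "g (insert s T) = h \<oplus>\<^bsub>D\<^esub> g T"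
        unfolding g_def h_def using insert s fs wsK TS f dualK
        by (auto simp: dual_bimodule_def intro!: restrict_ext K.finsum_insert)
      have gT: "g T \<in> carrier D" using insert by auto
      have "h \<oplus>\<^bsub>D\<^esub> g T \<in> carrier D"
      proof -
        have hg: "\<And>v. v \<in> carrier V \<Longrightarrow> h v \<in> carrier K" "\<And>v. v \<in> carrier V \<Longrightarrow> g T v \<in> carrier K"
          using h gT dualK by auto
        have "(\<lambda>v\<in>carrier V. h v \<oplus>\<^bsub>K\<^esub> g T v) \<in> carrier D"
          using h gT hg unfolding dual_carrier_iff
          by (auto simp: K.a_ac K.r_distr)
        then show ?thesis by (simp add: dual_bimodule_def)
      qed
      moreover have "\<Phi> (h \<oplus>\<^bsub>D\<^esub> g T) = f s \<otimes>\<^bsub>K\<^esub> \<Phi> (w s) \<oplus>\<^bsub>K\<^esub> (\<Oplus>\<^bsub>K\<^esub>s\<in>T. f s \<otimes>\<^bsub>K\<^esub> \<Phi> (w s))"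
        using add[OF h gT] scale[OF fs s(3)] insert by (simp add: h_def)
      moreover have "\<dots> = (\<Oplus>\<^bsub>K\<^esub>s\<in>insert s T. f s \<otimes>\<^bsub>K\<^esub> \<Phi> (w s))"
        using insert s fs TS f dualK closed by (intro K.finsum_insert[symmetric]) auto
      ultimately show ?case using split by simp
    qed
    \<comment> \<open>On the carrier this is the dual basis expansion; outside it both functions are
      \<open>undefined\<close>.\<close>
    have "g S = f"
    proof
      fix v
      show "g S v = f v"
      proof (cases "v \<in> carrier V")
        case True
        have "f v = f (\<Oplus>\<^bsub>V\<^esub>s\<in>S. w s v \<odot>\<^bsub>V\<^esub> s)"
          by (rule arg_cong[OF Sw(4)[OF True]])
        also have "\<dots> = (\<Oplus>\<^bsub>K\<^esub>s\<in>S. w s v \<otimes>\<^bsub>K\<^esub> f s)"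
          by (rule dual_finsum[OF f Sw(1,2)]) (use Sw(2,3) dualK True in auto)
        also have "\<dots> = (\<Oplus>\<^bsub>K\<^esub>s\<in>S. f s \<otimes>\<^bsub>K\<^esub> w s v)"
          using Sw(2,3) dualK True f by (intro K.finsum_cong') (auto intro!: K.m_comm K.m_closed)
        finally show ?thesis using True by (simp add: g_def)
      next
        case False
        moreover have "f v = undefined"
          using f False unfolding dual_carrier_iff by (intro PiE_arb) auto
        ultimately show ?thesis by (simp add: g_def)
      qed
    qed
    then have "\<Phi> f = (\<Oplus>\<^bsub>K\<^esub>s\<in>S. f s \<otimes>\<^bsub>K\<^esub> \<Phi> (w s))" using g[OF Sw(1)] by simp
    also have "\<dots> = (\<Oplus>\<^bsub>K\<^esub>s\<in>S. \<Phi> (w s) \<otimes>\<^bsub>K\<^esub> f s)"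
      using Sw(2,3) dualK f closed by (intro K.finsum_cong') (auto intro!: K.m_comm K.m_closed)
    also have "\<dots> = f a"
      unfolding a_def by (rule dual_finsum[OF f Sw(1,2), symmetric]) (use Sw(2,3) closed in auto)
    finally show ?thesis .
  qed
  moreover have "a \<in> carrier V" unfolding a_def using Sw(2,3) closed by (intro M.finsum_closed) auto
  ultimately show thesis by (intro that)
qed

end


section \<open>The right algebra of a bocs\<close>

text \<open>A tensor product appears as \<open>add_monoid (tensor S M N)\<close> when it is the
  target of a lift and as \<open>tensor_group S M N\<close> when it is the source. These equations
  allow two lifts to be composed.\<close>

lemma hom_tensor_simps:
  "hom (add_monoid (tensor S M N)) H = hom (tensor_group S M N) H"
  "hom H (add_monoid (tensor S M N)) = hom H (tensor_group S M N)"
  by (simp_all add: hom_def)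

lemma mult_bimodule_simps [simp]:
  "carrier (mult_bimodule A S) = S"
  "\<zero>\<^bsub>mult_bimodule A S\<^esub> = \<zero>\<^bsub>A\<^esub>"
  "add (mult_bimodule A S) = add A"
  "ract (mult_bimodule A S) = monoid.mult A"
  "lact (mult_bimodule A S) = monoid.mult A"
  by (simp_all add: mult_bimodule_def)

section \<open>Consequences of the bocs axioms for an arbitrary bimodule\<close>

locale bocs_ring = A: ring A
  for K :: "('k, 'x) ring_scheme" and A :: "('k, 'a) module" and W :: "('a, 'a, 'w) bimodule"
    and \<mu> \<epsilon> +
  assumes bocs: "bocs K A W \<mu> \<epsilon>"
begin

abbreviation "R \<equiv> regular_bimodule A"

sublocale W: bimodule K A W
  using bocs by (simp add: bocs_def)

sublocale R: abelian_group R
  by (rule abelian_groupI) (auto simp: A.a_ac intro: A.l_neg)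

sublocale WW: tensor_factors A W W
  by unfold_locales (auto intro: W.ract_closed W.lact_closed)

sublocale RW: tensor_factors A R W
  by unfold_locales (auto intro: W.lact_closed)

sublocale WR: tensor_factors A W R
  by unfold_locales (auto intro: W.ract_closed)

lemma rmod_homD:
  assumes "f \<in> rmod_hom A W R"
  shows "\<And>x. x \<in> carrier W \<Longrightarrow> f x \<in> carrier A"
    and "\<And>x y. \<lbrakk>x \<in> carrier W; y \<in> carrier W\<rbrakk> \<Longrightarrow> f (x \<oplus>\<^bsub>W\<^esub> y) = f x \<oplus>\<^bsub>A\<^esub> f y"
    and "\<And>x a. \<lbrakk>x \<in> carrier W; a \<in> carrier A\<rbrakk> \<Longrightarrow> f (x \<triangleleft>\<^bsub>W\<^esub> a) = f x \<otimes>\<^bsub>A\<^esub> a"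
    and "f \<in> extensional (carrier W)"
  using assms by (auto simp: rmod_hom_def PiE_def)

lemma counit_rmod_hom: "\<epsilon> \<in> rmod_hom A W R"
  using bocs by (simp add: bocs_def bimod_hom_def)

lemma counit_lact: "\<lbrakk>a \<in> carrier A; x \<in> carrier W\<rbrakk> \<Longrightarrow> \<epsilon> (a \<triangleright>\<^bsub>W\<^esub> x) = a \<otimes>\<^bsub>A\<^esub> \<epsilon> x"
  using bocs by (simp add: bocs_def bimod_hom_def)

lemmas counit = rmod_homD[OF counit_rmod_hom]

lemma comult:
  shows "\<And>x. x \<in> carrier W \<Longrightarrow> \<mu> x \<in> carrier (tensor_group A W W)"
    and "\<And>x y. \<lbrakk>x \<in> carrier W; y \<in> carrier W\<rbrakk> \<Longrightarrow>
      \<mu> (x \<oplus>\<^bsub>W\<^esub> y) = \<mu> x \<otimes>\<^bsub>tensor_group A W W\<^esub> \<mu> y"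
    and "\<And>x a. \<lbrakk>x \<in> carrier W; a \<in> carrier A\<rbrakk> \<Longrightarrow> \<mu> (x \<triangleleft>\<^bsub>W\<^esub> a) = \<mu> x \<triangleleft>\<^bsub>tensor A W W\<^esub> a"
  using bocs by (auto simp: bocs_def bimod_hom_def rmod_hom_def)

text \<open>\<open>f \<otimes> id : W \<otimes>\<^sub>A W \<rightarrow> A \<otimes>\<^sub>A W = W\<close>.\<close>

definition contract :: "('w \<Rightarrow> 'a) \<Rightarrow> (('w \<times> 'w) \<Rightarrow>\<^sub>0 int) set \<Rightarrow> 'w" where
  "contract f = tensor_lift W (\<lambda>x y. f x \<triangleright>\<^bsub>W\<^esub> y)"

lemma lact_lift_balanced: "balanced A R W W (\<lambda>a y. a \<triangleright>\<^bsub>W\<^esub> y)"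
  unfolding balanced_def
  by (auto simp: W.lact_closed W.lact_distr_module W.lact_distr_ring W.lact_mult)

context
  fixes f assumes f: "f \<in> rmod_hom A W R"
begin

text \<open>Balancedness over \<open>A\<close> is where right linearity of \<open>f\<close> enters,
  together with associativity of the left action.\<close>

lemma contract_balanced: "balanced A W W W (\<lambda>x y. f x \<triangleright>\<^bsub>W\<^esub> y)"
  unfolding balanced_def using rmod_homD[OF f]
  by (auto simp: W.lact_closed W.lact_distr_module W.lact_distr_ring W.lact_mult)

lemma contract_hom: "contract f \<in> hom (tensor_group A W W) (add_monoid W)"
  unfolding contract_def by (rule WW.tensor_lift_hom[OF W.abelian_group_axioms contract_balanced])

lemma contract_closed: "t \<in> carrier (tensor_group A W W) \<Longrightarrow> contract f t \<in> carrier W"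
  using hom_in_carrier[OF contract_hom] by simp

lemma contract_pure:
  "\<lbrakk>x \<in> carrier W; y \<in> carrier W\<rbrakk> \<Longrightarrow> contract f (pure_tensor A W W x y) = f x \<triangleright>\<^bsub>W\<^esub> y"
  unfolding contract_def by (rule WW.tensor_lift_pure[OF W.abelian_group_axioms contract_balanced])

lemma tensor_map_RW_balanced:
  "balanced A W W (tensor A R W) (\<lambda>x y. pure_tensor A R W (f x) y)"
  using RW.pure_tensor_balanced rmod_homD[OF f] unfolding balanced_def by simp

text \<open>Fuses the two successive lifts in the product of \<open>bocs_right_hom_ring\<close> into
  one; both sides are additive and agree on pure tensors.\<close>

lemma contract_eq:
  assumes t: "t \<in> carrier (tensor_group A W W)"
  shows "tensor_lift W (\<lambda>a y. a \<triangleright>\<^bsub>W\<^esub> y) (tensor_map A R W f (\<lambda>y. y) t) = contract f t"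
proof -
  note map = WW.tensor_lift_hom[OF RW.tensor_abelian_group tensor_map_RW_balanced]
  note lift = RW.tensor_lift_hom[OF W.abelian_group_axioms lact_lift_balanced]
  have "(tensor_lift W (\<lambda>a y. a \<triangleright>\<^bsub>W\<^esub> y) \<circ> tensor_map A R W f (\<lambda>y. y)) t = contract f t"
    using t
  proof (rule WW.tensor_hom_eqI[OF W.abelian_group_axioms _ contract_hom, rotated -1])
    show "tensor_lift W (\<lambda>a y. a \<triangleright>\<^bsub>W\<^esub> y) \<circ> tensor_map A R W f (\<lambda>y. y)
        \<in> hom (tensor_group A W W) (add_monoid W)"
      unfolding tensor_map_def using hom_compose[OF map[unfolded hom_tensor_simps] lift] .
  next
    fix x y assume xy: "x \<in> carrier W" "y \<in> carrier W"
    then show "(tensor_lift W (\<lambda>a y. a \<triangleright>\<^bsub>W\<^esub> y) \<circ> tensor_map A R W f (\<lambda>y. y))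
        (pure_tensor A W W x y) = contract f (pure_tensor A W W x y)"
      using rmod_homD(1)[OF f xy(1)]
      by (simp add: tensor_map_def contract_pure
          WW.tensor_lift_pure[OF RW.tensor_abelian_group tensor_map_RW_balanced]
          RW.tensor_lift_pure[OF W.abelian_group_axioms lact_lift_balanced])
  qed
  then show ?thesis by simp
qed

text \<open>The right action touches only the second tensor factor and commutes with the left action
  of \<open>f x\<close>.\<close>

lemma contract_ract:
  assumes b: "b \<in> carrier A" and t: "t \<in> carrier (tensor_group A W W)"
  shows "contract f (t \<triangleleft>\<^bsub>tensor A W W\<^esub> b) = contract f t \<triangleleft>\<^bsub>W\<^esub> b"
proof -
  have bal: "balanced A W W (tensor A W W) (\<lambda>x y. pure_tensor A W W x (y \<triangleleft>\<^bsub>W\<^esub> b))"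
    using WW.pure_tensor_balanced b unfolding balanced_def
    by (simp add: W.ract_closed W.lact_closed W.ract_distr_module W.lact_ract)
  have ract: "(\<lambda>w. w \<triangleleft>\<^bsub>W\<^esub> b) \<in> hom (add_monoid W) (add_monoid W)"
    using b by (auto simp: hom_def W.ract_closed W.ract_distr_module)
  let ?r = "tensor_lift (tensor A W W) (\<lambda>x y. pure_tensor A W W x (y \<triangleleft>\<^bsub>W\<^esub> b))"
  have "(contract f \<circ> ?r) t = ((\<lambda>w. w \<triangleleft>\<^bsub>W\<^esub> b) \<circ> contract f) t"
    using t
  proof (rule WW.tensor_hom_eqI[OF W.abelian_group_axioms, rotated -1])
    show "contract f \<circ> ?r \<in> hom (tensor_group A W W) (add_monoid W)"
      using hom_compose[OF WW.tensor_lift_hom[OF WW.tensor_abelian_group bal, unfolded hom_tensor_simps] contract_hom] .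
    show "(\<lambda>w. w \<triangleleft>\<^bsub>W\<^esub> b) \<circ> contract f \<in> hom (tensor_group A W W) (add_monoid W)"
      using hom_compose[OF contract_hom ract] .
  next
    fix x y assume xy: "x \<in> carrier W" "y \<in> carrier W"
    then show "(contract f \<circ> ?r) (pure_tensor A W W x y) =
        ((\<lambda>w. w \<triangleleft>\<^bsub>W\<^esub> b) \<circ> contract f) (pure_tensor A W W x y)"
      using b rmod_homD(1)[OF f xy(1)]
      by (simp add: WW.tensor_lift_pure[OF WW.tensor_abelian_group bal] contract_pure
          W.ract_closed W.lact_ract)
  qed
  then show ?thesis by (simp add: tensor_ract)
qed

text \<open>This is the endomorphism \<open>G\<^sub>f\<close>, a composite of two right linear
  maps.\<close>

lemma contract_comult_rmod_hom: "(\<lambda>w\<in>carrier W. contract f (\<mu> w)) \<in> rmod_hom A W W"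
proof -
  have "contract f (\<mu> (x \<oplus>\<^bsub>W\<^esub> y)) = contract f (\<mu> x) \<oplus>\<^bsub>W\<^esub> contract f (\<mu> y)"
    if "x \<in> carrier W" "y \<in> carrier W" for x y
    using hom_mult[OF contract_hom] that comult by simp
  then show ?thesis
    by (auto simp: rmod_hom_def comult contract_closed contract_ract W.ract_closed)
qed

text \<open>The counit law \<open>(id \<otimes> \<epsilon>) \<mu> = c\<^sub>l\<close> recovers \<open>f\<close> from \<open>(f \<otimes> id) \<mu>\<close>, which gives surjectivity of \<open>\<zeta>\<close>.\<close>

lemma counit_contract_comult:
  assumes w: "w \<in> carrier W"
  shows "\<epsilon> (contract f (\<mu> w)) = f w"
proof -
  have bal: "balanced A W R A (\<lambda>x a. f x \<otimes>\<^bsub>A\<^esub> a)"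
    unfolding balanced_def using rmod_homD[OF f]
    by (auto simp: A.l_distr A.r_distr A.m_assoc)
  have map_bal: "balanced A W W (tensor A W R) (\<lambda>x y. pure_tensor A W R x (\<epsilon> y))"
    using WR.pure_tensor_balanced counit counit_lact unfolding balanced_def by simp
  note map = WW.tensor_lift_hom[OF WR.tensor_abelian_group map_bal]
  note lift = WR.tensor_lift_hom[OF A.abelian_group_axioms bal]
  have eps: "\<epsilon> \<in> hom (add_monoid W) (add_monoid A)"
    using counit by (auto simp: hom_def)
  \<comment> \<open>Left linearity of \<epsilon> turns \<epsilon>(f(x) y) into f(x) \<epsilon>(y),
    so the left-hand side factors through the map in the counit law, which sends \<mu>(w) to the
    pure tensor of w and 1.\<close>
  have "(\<epsilon> \<circ> contract f) (\<mu> w) =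
      (tensor_lift A (\<lambda>x a. f x \<otimes>\<^bsub>A\<^esub> a) \<circ> tensor_map A W R (\<lambda>x. x) \<epsilon>) (\<mu> w)"
    using comult(1)[OF w]
  proof (rule WW.tensor_hom_eqI[OF A.abelian_group_axioms, rotated -1])
    show "\<epsilon> \<circ> contract f \<in> hom (tensor_group A W W) (add_monoid A)"
      using hom_compose[OF contract_hom eps] .
    show "tensor_lift A (\<lambda>x a. f x \<otimes>\<^bsub>A\<^esub> a) \<circ> tensor_map A W R (\<lambda>x. x) \<epsilon>
        \<in> hom (tensor_group A W W) (add_monoid A)"
      unfolding tensor_map_def using hom_compose[OF map[unfolded hom_tensor_simps] lift] .
  next
    fix x y assume xy: "x \<in> carrier W" "y \<in> carrier W"
    then show "(\<epsilon> \<circ> contract f) (pure_tensor A W W x y) =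
      (tensor_lift A (\<lambda>x a. f x \<otimes>\<^bsub>A\<^esub> a) \<circ> tensor_map A W R (\<lambda>x. x) \<epsilon>) (pure_tensor A W W x y)"
      using rmod_homD(1)[OF f xy(1)] counit(1)[OF xy(2)]
      by (simp add: tensor_map_def contract_pure counit_lact
          WW.tensor_lift_pure[OF WR.tensor_abelian_group map_bal]
          WR.tensor_lift_pure[OF A.abelian_group_axioms bal])
  qed
  moreover have "tensor_map A W R (\<lambda>x. x) \<epsilon> (\<mu> w) = pure_tensor A W R w \<one>\<^bsub>A\<^esub>"
    using bocs w by (simp add: bocs_def)
  ultimately show ?thesis
    using w rmod_homD(1)[OF f w] WR.tensor_lift_pure[OF A.abelian_group_axioms bal, of w "\<one>\<^bsub>A\<^esub>"]
    by simp
qed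

text \<open>For left linear \<open>g\<close> one has g(f(x) y) = f(x) g(y). Hence the product of
  \<open>bocs_bimod_hom_ring\<close> agrees with that of \<open>bocs_right_hom_ring\<close> on
  bimodule maps.\<close>

lemma comp_contract_comult:
  assumes g: "g \<in> bimod_hom A W R" and w: "w \<in> carrier W"
  shows "tensor_lift A (\<lambda>x y. f x \<otimes>\<^bsub>A\<^esub> g y) (\<mu> w) = g (contract f (\<mu> w))"
proof -
  have g': "g \<in> rmod_hom A W R" and
    g_lact: "\<And>a x. \<lbrakk>a \<in> carrier A; x \<in> carrier W\<rbrakk> \<Longrightarrow> g (a \<triangleright>\<^bsub>W\<^esub> x) = a \<otimes>\<^bsub>A\<^esub> g x"
    using g by (auto simp: bimod_hom_def)
  note g'D = rmod_homD[OF g']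
  have bal: "balanced A W W A (\<lambda>x y. f x \<otimes>\<^bsub>A\<^esub> g y)"
    unfolding balanced_def using rmod_homD[OF f] g'D g_lact
    by (auto simp: A.l_distr A.r_distr A.m_assoc)
  have "g \<in> hom (add_monoid W) (add_monoid A)"
    using g'D by (auto simp: hom_def)
  then have "g \<circ> contract f \<in> hom (tensor_group A W W) (add_monoid A)"
    using hom_compose[OF contract_hom] by blast
  from WW.tensor_hom_eqI[OF A.abelian_group_axioms
      WW.tensor_lift_hom[OF A.abelian_group_axioms bal] this _ comult(1)[OF w]]
  have "tensor_lift A (\<lambda>x y. f x \<otimes>\<^bsub>A\<^esub> g y) (\<mu> w) = (g \<circ> contract f) (\<mu> w)"
    by (simp add: WW.tensor_lift_pure[OF A.abelian_group_axioms bal] contract_pure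
        g_lact rmod_homD(1)[OF f])
  then show ?thesis by simp
qed

end

text \<open>The counit law (\<epsilon> \<otimes> id) \<mu> = \<open>c\<^sub>r\<close>, read in
  \<open>W\<close> through the identification of \<open>A \<otimes>\<^sub>A W\<close> with
  \<open>W\<close>.\<close>

lemma contract_counit:
  assumes w: "w \<in> carrier W"
  shows "contract \<epsilon> (\<mu> w) = w"
proof -
  have "tensor_map A R W \<epsilon> (\<lambda>x. x) (\<mu> w) = pure_tensor A R W \<one>\<^bsub>A\<^esub> w"
    using bocs w by (simp add: bocs_def)
  then show ?thesis
    using contract_eq[OF counit_rmod_hom comult(1)[OF w]] w
      RW.tensor_lift_pure[OF W.abelian_group_axioms lact_lift_balanced, of "\<one>\<^bsub>A\<^esub>" w]
    by (simp add: W.lact_one)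
qed

section \<open>The map \<open>zeta\<close> and its contractions\<close>

definition zeta :: "'a \<Rightarrow> 'w \<Rightarrow> 'a" where
  "zeta a = (\<lambda>x\<in>carrier W. \<epsilon> (a \<triangleright>\<^bsub>W\<^esub> x))"

lemma zeta_apply: "x \<in> carrier W \<Longrightarrow> zeta a x = \<epsilon> (a \<triangleright>\<^bsub>W\<^esub> x)"
  by (simp add: zeta_def)

lemma zeta_rmod_hom: "a \<in> carrier A \<Longrightarrow> zeta a \<in> rmod_hom A W R"
  using counit
  by (auto simp: zeta_def rmod_hom_def W.lact_closed W.ract_closed W.lact_distr_module
      simp flip: W.lact_ract)

text \<open>By left linearity of \<epsilon>, contracting with \<open>zeta a\<close> is contracting
  with \<epsilon> followed by left multiplication by \<open>a\<close>, and contracting \<mu>(w) with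
  \<epsilon> returns w.\<close>

lemma contract_zeta:
  assumes a: "a \<in> carrier A" and w: "w \<in> carrier W"
  shows "contract (zeta a) (\<mu> w) = a \<triangleright>\<^bsub>W\<^esub> w"
proof -
  have "(\<lambda>w. a \<triangleright>\<^bsub>W\<^esub> w) \<in> hom (add_monoid W) (add_monoid W)"
    using a by (auto simp: hom_def W.lact_closed W.lact_distr_module)
  then have "(\<lambda>w. a \<triangleright>\<^bsub>W\<^esub> w) \<circ> contract \<epsilon> \<in> hom (tensor_group A W W) (add_monoid W)"
    using hom_compose[OF contract_hom[OF counit_rmod_hom]] by blast
  from WW.tensor_hom_eqI[OF W.abelian_group_axioms
      contract_hom[OF zeta_rmod_hom[OF a]] this _ comult(1)[OF w]]
  have "contract (zeta a) (\<mu> w) = ((\<lambda>w. a \<triangleright>\<^bsub>W\<^esub> w) \<circ> contract \<epsilon>) (\<mu> w)"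
    using a
    by (simp add: contract_pure[OF zeta_rmod_hom[OF a]] contract_pure[OF counit_rmod_hom]
        zeta_apply counit_lact counit W.lact_mult)
  then show ?thesis by (simp add: contract_counit w)
qed

end

section \<open>Opposite ring and center, from which the ring structures are transported\<close>

lemma (in ring) opposite_ring: "ring (opposite_ring R)"
proof (rule ringI)
  show "abelian_group (opposite_ring R)"
    by (rule abelian_groupI) (auto simp: opposite_ring_def a_ac intro: l_neg)
  show "monoid (opposite_ring R)"
    by (rule monoidI) (auto simp: opposite_ring_def m_assoc)
qed (auto simp: opposite_ring_def l_distr r_distr)

lemma (in ring) ring_center: "ring (ring_center R)"
proof -
  let ?Z = "carrier (ring_center R)"
  have in_carrier: "z \<in> carrier R" if "z \<in> ?Z" for z
    using that by (simp add: ring_center_def)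
  have comm: "z \<otimes> a = a \<otimes> z" if "z \<in> ?Z" "a \<in> carrier R" for z a
    using that by (simp add: ring_center_def)
  have centralI: "z \<in> ?Z" if "z \<in> carrier R" "\<And>a. a \<in> carrier R \<Longrightarrow> z \<otimes> a = a \<otimes> z" for z
    using that by (simp add: ring_center_def)
  have ops [simp]: "add (ring_center R) = add R" "monoid.mult (ring_center R) = monoid.mult R"
    "\<zero>\<^bsub>ring_center R\<^esub> = \<zero>" "\<one>\<^bsub>ring_center R\<^esub> = \<one>"
    by (simp_all add: ring_center_def)
  have add: "y \<oplus> z \<in> ?Z" if yz: "y \<in> ?Z" "z \<in> ?Z" for y z
    using in_carrier[OF yz(1)] in_carrier[OF yz(2)]
    by (intro centralI) (simp_all add: l_distr r_distr comm[OF yz(1)] comm[OF yz(2)])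
  have neg: "\<ominus> z \<in> ?Z" if z: "z \<in> ?Z" for z
    using in_carrier[OF z] by (intro centralI) (simp_all add: l_minus r_minus comm[OF z])
  have mult: "y \<otimes> z \<in> ?Z" if yz: "y \<in> ?Z" "z \<in> ?Z" for y z
  proof (rule centralI)
    have y: "y \<in> carrier R" and z: "z \<in> carrier R" using yz by (auto intro: in_carrier)
    then show "y \<otimes> z \<in> carrier R" by simp
    fix a assume a: "a \<in> carrier R"
    have "y \<otimes> z \<otimes> a = y \<otimes> a \<otimes> z"
      using y z a by (simp add: m_assoc comm[OF yz(2)])
    also have "\<dots> = a \<otimes> (y \<otimes> z)"
      using y z a by (simp add: comm[OF yz(1) a] m_assoc)
    finally show "y \<otimes> z \<otimes> a = a \<otimes> (y \<otimes> z)" .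
  qed
  have zero: "\<zero> \<in> ?Z" and one: "\<one> \<in> ?Z" by (auto intro: centralI)
  show ?thesis
  proof (rule ringI)
    show "abelian_group (ring_center R)"
      by (rule abelian_groupI)
        (auto simp: a_ac in_carrier add zero r_neg intro!: bexI[OF _ neg])
    show "monoid (ring_center R)"
      by (rule monoidI) (auto simp: m_assoc in_carrier mult one)
  qed (auto simp: in_carrier l_distr r_distr)
qed

text \<open>The bocses for which the left action identifies \<open>A\<close> with the endomorphism ring of \<open>W\<^sub>A\<close>.\<close>

locale endo_bocs_ring = bocs_ring +
  assumes lact_faithful:
      "\<lbrakk>a \<in> carrier A; b \<in> carrier A; \<And>w. w \<in> carrier W \<Longrightarrow> a \<triangleright>\<^bsub>W\<^esub> w = b \<triangleright>\<^bsub>W\<^esub> w\<rbrakk> \<Longrightarrow> a = b"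
    and endo_lact:
      "g \<in> rmod_hom A W W \<Longrightarrow> \<exists>a\<in>carrier A. \<forall>w\<in>carrier W. g w = a \<triangleright>\<^bsub>W\<^esub> w"
begin

section \<open>The two rings of homomorphisms described by \<open>zeta\<close>\<close>

abbreviation "right_ring \<equiv> bocs_right_hom_ring A W \<mu> \<epsilon>"
abbreviation "bimod_ring \<equiv> bocs_bimod_hom_ring A W \<mu> \<epsilon>"

text \<open>By \<open>contract_zeta\<close>, the map \<open>zeta a\<close> determines left
  multiplication by \<open>a\<close>, which determines \<open>a\<close> by faithfulness.\<close>

lemma zeta_inj: "inj_on zeta (carrier A)"
proof (rule inj_onI)
  fix a b assume ab: "a \<in> carrier A" "b \<in> carrier A" and "zeta a = zeta b"
  then show "a = b"
    using contract_zeta[OF ab(1)] contract_zeta[OF ab(2)] by (intro lact_faithful) auto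
qed

lemma zeta_surj:
  assumes f: "f \<in> rmod_hom A W R"
  obtains a where "a \<in> carrier A" and "f = zeta a"
proof -
  obtain a where a: "a \<in> carrier A" "\<And>w. w \<in> carrier W \<Longrightarrow> contract f (\<mu> w) = a \<triangleright>\<^bsub>W\<^esub> w"
    using endo_lact[OF contract_comult_rmod_hom[OF f]] by auto
  have "f = zeta a"
  proof (rule extensionalityI[OF rmod_homD(4)[OF f]])
    show "zeta a \<in> extensional (carrier W)" by (simp add: zeta_def)
    show "f w = zeta a w" if "w \<in> carrier W" for w
      using counit_contract_comult[OF f that] a that by (simp add: zeta_def)
  qed
  with a(1) show thesis by (rule that)
qed

text \<open>Source of the reversed order: the contraction with \<open>zeta a\<close> multiplies by
  \<open>a\<close> first, and \<open>zeta b\<close> then puts \<open>b\<close> to its left.\<close>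

lemma zeta_comp:
  "\<lbrakk>a \<in> carrier A; b \<in> carrier A; x \<in> carrier W\<rbrakk> \<Longrightarrow> zeta b (contract (zeta a) (\<mu> x)) = zeta (b \<otimes>\<^bsub>A\<^esub> a) x"
  unfolding contract_zeta by (simp add: zeta_def W.lact_closed W.lact_mult)

lemma zeta_add:
  "\<lbrakk>a \<in> carrier A; b \<in> carrier A\<rbrakk> \<Longrightarrow>
   zeta (a \<oplus>\<^bsub>A\<^esub> b) = (\<lambda>x\<in>carrier W. zeta a x \<oplus>\<^bsub>A\<^esub> zeta b x)"
  by (auto simp: zeta_def W.lact_distr_ring W.lact_closed counit)

lemma zeta_one: "zeta \<one>\<^bsub>A\<^esub> = \<epsilon>"
  by (rule extensionalityI[OF _ counit(4)]) (auto simp: zeta_def W.lact_one)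

text \<open>Transport along an isomorphism produces a ring whose zero is the image of zero; this
  identifies it with the zero of the Hom rings.\<close>

lemma zeta_zero: "zeta \<zero>\<^bsub>A\<^esub> = (\<lambda>x\<in>carrier W. \<zero>\<^bsub>A\<^esub>)"
proof -
  have "\<epsilon> (\<zero>\<^bsub>A\<^esub> \<triangleright>\<^bsub>W\<^esub> x) = \<zero>\<^bsub>A\<^esub>" if "x \<in> carrier W" for x
    using that counit_lact[of "\<zero>\<^bsub>A\<^esub>" x] counit(1) by simp
  then show ?thesis by (auto simp: zeta_def)
qed

lemma zeta_anti_iso: "zeta \<in> ring_anti_iso A right_ring"
  unfolding ring_anti_iso_def
proof (rule ring_iso_memI)
  show "bij_betw zeta (carrier (opposite_ring A)) (carrier right_ring)"
    using zeta_inj zeta_rmod_hom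
    by (auto simp: bij_betw_def opposite_ring_def bocs_right_hom_ring_def elim: zeta_surj)
next
  fix a b assume "a \<in> carrier (opposite_ring A)" "b \<in> carrier (opposite_ring A)"
  then have ab: "a \<in> carrier A" "b \<in> carrier A" by (simp_all add: opposite_ring_def)
  have "zeta (b \<otimes>\<^bsub>A\<^esub> a) = (\<lambda>x\<in>carrier W. zeta b (contract (zeta a) (\<mu> x)))"
    by (rule extensionalityI[where A = "carrier W"]) (auto simp: zeta_comp ab, simp add: zeta_def)
  also have "\<dots> = zeta a \<otimes>\<^bsub>right_ring\<^esub> zeta b"
    unfolding bocs_right_hom_ring_def
    by (simp add: contract_eq[OF zeta_rmod_hom[OF ab(1)]] comult cong: restrict_cong)
  finally show "zeta (a \<otimes>\<^bsub>opposite_ring A\<^esub> b) = zeta a \<otimes>\<^bsub>right_ring\<^esub> zeta b"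
    by (simp add: opposite_ring_def)
  show "zeta (a \<oplus>\<^bsub>opposite_ring A\<^esub> b) = zeta a \<oplus>\<^bsub>right_ring\<^esub> zeta b"
    using ab by (simp add: opposite_ring_def bocs_right_hom_ring_def zeta_add)
qed (auto simp: opposite_ring_def bocs_right_hom_ring_def zeta_rmod_hom zeta_one)

text \<open>The ring axioms are transported from the opposite ring along
  \<open>zeta\<close>.\<close>

lemma right_ring: "ring right_ring"
proof -
  have "ring (right_ring\<lparr>zero := zeta \<zero>\<^bsub>opposite_ring A\<^esub>\<rparr>)"
    using ring.ring_iso_imp_img_ring[OF A.opposite_ring] zeta_anti_iso
    unfolding ring_anti_iso_def by blast
  also have "zeta \<zero>\<^bsub>opposite_ring A\<^esub> = \<zero>\<^bsub>right_ring\<^esub>"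
    by (simp add: opposite_ring_def bocs_right_hom_ring_def zeta_zero)
  finally show ?thesis by simp
qed

text \<open>Left linearity at \<open>b\<close> compares \<epsilon>(abx) with b \<epsilon>(ax) =
  \<epsilon>(bax). It therefore says that \<open>zeta\<close> agrees at ab and ba, and
  \<open>zeta\<close> is injective.\<close>

lemma zeta_bimod_hom_iff:
  assumes a: "a \<in> carrier A"
  shows "zeta a \<in> bimod_hom A W R \<longleftrightarrow> a \<in> carrier (ring_center A)"
proof -
  have "zeta a \<in> bimod_hom A W R \<longleftrightarrow> (\<forall>b\<in>carrier A. zeta (a \<otimes>\<^bsub>A\<^esub> b) = zeta (b \<otimes>\<^bsub>A\<^esub> a))"
    using a zeta_rmod_hom[OF a]
    by (auto simp: bimod_hom_def zeta_def W.lact_closed W.lact_mult counit_lact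
        fun_eq_iff restrict_def)
  also have "\<dots> \<longleftrightarrow> (\<forall>b\<in>carrier A. a \<otimes>\<^bsub>A\<^esub> b = b \<otimes>\<^bsub>A\<^esub> a)"
    using a inj_onD[OF zeta_inj] by auto
  finally show ?thesis using a by (simp add: ring_center_def)
qed

lemma zeta_center_iso: "zeta \<in> ring_iso (ring_center A) bimod_ring"
proof (rule ring_iso_memI)
  have center: "carrier (ring_center A) \<subseteq> carrier A" by (auto simp: ring_center_def)
  have "zeta ` carrier (ring_center A) = bimod_hom A W R"
  proof
    show "zeta ` carrier (ring_center A) \<subseteq> bimod_hom A W R"
      using zeta_bimod_hom_iff center by auto
    show "bimod_hom A W R \<subseteq> zeta ` carrier (ring_center A)"
    proof
      fix f assume f: "f \<in> bimod_hom A W R"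
      then have "f \<in> rmod_hom A W R" by (simp add: bimod_hom_def)
      then obtain a where "a \<in> carrier A" "f = zeta a" by (rule zeta_surj)
      with f show "f \<in> zeta ` carrier (ring_center A)" using zeta_bimod_hom_iff by blast
    qed
  qed
  then show bij: "bij_betw zeta (carrier (ring_center A)) (carrier bimod_ring)"
    using inj_on_subset[OF zeta_inj center] by (simp add: bij_betw_def bocs_bimod_hom_ring_def)
  fix a assume a: "a \<in> carrier (ring_center A)"
  then show "zeta a \<in> carrier bimod_ring" using bij by (auto simp: bij_betw_def)
  fix b assume b: "b \<in> carrier (ring_center A)"
  have ab: "a \<in> carrier A" "b \<in> carrier A" using a b center by auto
  \<comment> \<open>Centrality undoes the order reversal of \<open>zeta_comp\<close>; the product is
    then rewritten by \<open>comp_contract_comult\<close>, since \<open>zeta b\<close> is a bimodule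
    map.\<close>
  have "zeta (a \<otimes>\<^bsub>A\<^esub> b) = zeta (b \<otimes>\<^bsub>A\<^esub> a)" using a ab by (simp add: ring_center_def)
  also have "\<dots> = (\<lambda>x\<in>carrier W. zeta b (contract (zeta a) (\<mu> x)))"
    by (rule extensionalityI[where A = "carrier W"]) (auto simp: zeta_comp ab, simp add: zeta_def)
  also have "\<dots> = zeta a \<otimes>\<^bsub>bimod_ring\<^esub> zeta b"
    using comp_contract_comult[OF zeta_rmod_hom[OF ab(1)], of "zeta b"] zeta_bimod_hom_iff[OF ab(2)] b
    by (simp add: bocs_bimod_hom_ring_def cong: restrict_cong)
  finally show "zeta (a \<otimes>\<^bsub>ring_center A\<^esub> b) = zeta a \<otimes>\<^bsub>bimod_ring\<^esub> zeta b"
    by (simp add: ring_center_def)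
  show "zeta (a \<oplus>\<^bsub>ring_center A\<^esub> b) = zeta a \<oplus>\<^bsub>bimod_ring\<^esub> zeta b"
    using ab by (simp add: ring_center_def bocs_bimod_hom_ring_def zeta_add)
qed (auto simp: ring_center_def bocs_bimod_hom_ring_def zeta_one)

lemma bimod_ring: "ring bimod_ring"
proof -
  have "ring (bimod_ring\<lparr>zero := zeta \<zero>\<^bsub>ring_center A\<^esub>\<rparr>)"
    using ring.ring_iso_imp_img_ring[OF A.ring_center zeta_center_iso] .
  also have "zeta \<zero>\<^bsub>ring_center A\<^esub> = \<zero>\<^bsub>bimod_ring\<^esub>"
    by (simp add: ring_center_def bocs_bimod_hom_ring_def zeta_zero)
  finally show ?thesis by simp
qed

lemma bimod_ring_iso_center: "bimod_ring \<simeq> ring_center A"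
  using ring_iso_sym[OF A.ring_center] zeta_center_iso unfolding is_ring_iso_def by blast

end

section \<open>The bimodule \<open>D(A)\<close> and the main result\<close>

lemma endo_bocs_ring_dual:
  assumes "fd_algebra K A" and bocs: "bocs K A (dual_bimodule K A) \<mu> \<epsilon>"
  shows "endo_bocs_ring K A (dual_bimodule K A) \<mu> \<epsilon>"
proof -
  interpret fd_algebra K A by fact
  interpret vector_space K A by unfold_locales
  interpret bocs_ring K A D \<mu> \<epsilon> by unfold_locales (rule bocs)
  have lact: "a \<triangleright>\<^bsub>D\<^esub> f = (\<lambda>x\<in>carrier A. f (x \<otimes>\<^bsub>A\<^esub> a))"
    and ract: "f \<triangleleft>\<^bsub>D\<^esub> a = (\<lambda>x\<in>carrier A. f (a \<otimes>\<^bsub>A\<^esub> x))"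
    and add: "f \<oplus>\<^bsub>D\<^esub> g = (\<lambda>x\<in>carrier A. f x \<oplus>\<^bsub>K\<^esub> g x)" for a f g
    by (simp_all add: dual_bimodule_def)
  have eval: "f x \<in> carrier K" if "f \<in> carrier D" "x \<in> carrier A" for f x
    using that by (auto simp: dual_carrier_iff)
  show ?thesis
  proof unfold_locales
    fix a b
    assume ab: "a \<in> carrier A" "b \<in> carrier A"
      and eq: "\<And>w. w \<in> carrier D \<Longrightarrow> a \<triangleright>\<^bsub>D\<^esub> w = b \<triangleright>\<^bsub>D\<^esub> w"
    show "a = b"
    proof (rule dual_separates[OF finite_dimensional ab])
      fix f assume f: "f \<in> carrier D"
      \<comment> \<open>The value of \<open>a \<triangleright> f\<close> at 1 is f(a).\<close>
      from fun_cong[OF eq[OF f], of "\<one>\<^bsub>A\<^esub>"] ab show "f a = f b" by (simp add: lact)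
    qed
  next
    fix g assume g: "g \<in> rmod_hom A D D"
    have g_closed: "g f \<in> carrier D" if "f \<in> carrier D" for f
      using g that by (auto simp: rmod_hom_def)
    have g_ract: "g (f \<triangleleft>\<^bsub>D\<^esub> a) = g f \<triangleleft>\<^bsub>D\<^esub> a" if "f \<in> carrier D" "a \<in> carrier A" for f a
      using g that by (auto simp: rmod_hom_def)
    obtain a where a: "a \<in> carrier A" "\<And>f. f \<in> carrier D \<Longrightarrow> g f \<one>\<^bsub>A\<^esub> = f a"
    proof (rule double_dual[OF finite_dimensional, of "\<lambda>f. g f \<one>\<^bsub>A\<^esub>"])
      show "g f \<one>\<^bsub>A\<^esub> \<in> carrier K" if "f \<in> carrier D" for f
        using eval[OF g_closed[OF that]] by simp
      show "g (f \<oplus>\<^bsub>D\<^esub> h) \<one>\<^bsub>A\<^esub> = g f \<one>\<^bsub>A\<^esub> \<oplus>\<^bsub>K\<^esub> g h \<one>\<^bsub>A\<^esub>" if "f \<in> carrier D" "h \<in> carrier D" for f h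
        using g that by (simp add: rmod_hom_def add)
      show "g (\<lambda>v\<in>carrier A. k \<otimes>\<^bsub>K\<^esub> f v) \<one>\<^bsub>A\<^esub> = k \<otimes>\<^bsub>K\<^esub> g f \<one>\<^bsub>A\<^esub>"
        if k: "k \<in> carrier K" and f: "f \<in> carrier D" for k f
      proof -
        \<comment> \<open>Scalars act on \<open>D\<close> through the right action of
          \<open>A\<close>, so right linearity of \<open>g\<close> includes linearity over
          \<open>K\<close>.\<close>
        have scale: "(\<lambda>v\<in>carrier A. k \<otimes>\<^bsub>K\<^esub> h v) = h \<triangleleft>\<^bsub>D\<^esub> (k \<odot>\<^bsub>A\<^esub> \<one>\<^bsub>A\<^esub>)" if h: "h \<in> carrier D" for h
          unfolding ract using k h
          by (intro restrict_ext) (simp add: smult_mult_left dual_carrier_iff)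
        have "g (\<lambda>v\<in>carrier A. k \<otimes>\<^bsub>K\<^esub> f v) = (\<lambda>v\<in>carrier A. k \<otimes>\<^bsub>K\<^esub> g f v)"
          unfolding scale[OF f] scale[OF g_closed[OF f]] using f k by (intro g_ract) auto
        then show ?thesis by simp
      qed
    qed (rule that)
    show "\<exists>a\<in>carrier A. \<forall>f\<in>carrier D. g f = a \<triangleright>\<^bsub>D\<^esub> f"
    proof (intro bexI[OF _ a(1)] ballI)
      fix f assume f: "f \<in> carrier D"
      show "g f = a \<triangleright>\<^bsub>D\<^esub> f"
      proof (rule extensionalityI[where A = "carrier A"])
        show "g f \<in> extensional (carrier A)"
          using g_closed[OF f] by (auto simp: dual_carrier_iff PiE_def)
        show "a \<triangleright>\<^bsub>D\<^esub> f \<in> extensional (carrier A)" by (simp add: lact)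
        fix x assume x: "x \<in> carrier A"
        have "g f x = (g f \<triangleleft>\<^bsub>D\<^esub> x) \<one>\<^bsub>A\<^esub>" using x by (simp add: ract)
        also have "\<dots> = (f \<triangleleft>\<^bsub>D\<^esub> x) a"
          using a(2)[OF W.ract_closed[OF f x]] g_ract[OF f x] by simp
        also have "\<dots> = (a \<triangleright>\<^bsub>D\<^esub> f) x" using x a(1) by (simp add: lact ract)
        finally show "g f x = (a \<triangleright>\<^bsub>D\<^esub> f) x" .
      qed
    qed
  qed
qed

theorem proposition2p7:
  fixes K :: "'k ring"
    and A :: "('k, 'a) module"
    and e :: 'a
    and \<phi> :: "(('a \<times> 'a) \<Rightarrow>\<^sub>0 int) set \<Rightarrow> ('a \<Rightarrow> 'k)"
    and \<mu> :: "('a \<Rightarrow> 'k) \<Rightarrow> ((('a \<Rightarrow> 'k) \<times> ('a \<Rightarrow> 'k)) \<Rightarrow>\<^sub>0 int) set"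
    and \<epsilon> :: "('a \<Rightarrow> 'k) \<Rightarrow> 'a"
  assumes "field K"
    and "fd_algebra K A"
    and "gendo_symmetric TYPE('b) TYPE('m) K A"
    and "e \<in> carrier A" and "e \<otimes>\<^bsub>A\<^esub> e = e"
    and "minimal_faithful_projective_injective K A (right_part A e)"
    and "\<phi> \<in> bimod_iso A (tensor (corner A e) (left_part A e) (right_part A e)) (dual_bimodule K A)"
    and "gendo_symmetric_bocs K A e \<phi> \<mu> \<epsilon>"
  shows "(ring (bocs_right_hom_ring A (dual_bimodule K A) \<mu> \<epsilon>) \<and>
          (\<lambda>a\<in>carrier A. \<lambda>x\<in>carrier (dual_bimodule K A). \<epsilon> (a \<triangleright>\<^bsub>dual_bimodule K A\<^esub> x))
            \<in> ring_anti_iso A (bocs_right_hom_ring A (dual_bimodule K A) \<mu> \<epsilon>)) \<and>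
         (ring (bocs_bimod_hom_ring A (dual_bimodule K A) \<mu> \<epsilon>) \<and>
          bocs_bimod_hom_ring A (dual_bimodule K A) \<mu> \<epsilon> \<simeq> ring_center A)"
proof -
  \<comment> \<open>The bocs axioms for \<mu> and \<epsilon> are part of
    \<open>gendo_symmetric_bocs\<close>.\<close>
  interpret endo_bocs_ring K A "dual_bimodule K A" \<mu> \<epsilon>
    using assms(2,8) by (intro endo_bocs_ring_dual) (auto simp: gendo_symmetric_bocs_def Let_def)
  \<comment> \<open>The map in the claim is extensional on \<open>carrier A\<close>; restricting
    \<open>zeta\<close> keeps it an isomorphism.\<close>
  have "(\<lambda>a\<in>carrier A. zeta a) \<in> ring_anti_iso A right_ring"
    using ring.ring_iso_restrict[OF A.opposite_ring] zeta_anti_iso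
    unfolding ring_anti_iso_def by (fastforce simp: opposite_ring_def)
  then show ?thesis
    using right_ring bimod_ring bimod_ring_iso_center unfolding zeta_def by blast
qed

end
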